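(* The diagram rewriting system $\mathfrak F$ (defined in the context) is convergent, i.e. it terminates and is confluent.
   Context: Diagrams. Given a finite set of gates, each with a number of inputs $p$ and outputs $q$ (written $p\Rightarrow q$), diagrams are the morphisms of the PRO (strict monoidal category with objects the natural numbers and tensor on objects given by addition) freely generated by the gates. Write $*$ for parallel composition (tensor), $f;g$ for sequential composition "first $f$, then $g$" (diagrams are read from inputs to outputs), and $1_n$ for the identity on $n$ strings, $1=1_1$. Diagrams are considered up to the strict monoidal category axioms (in particular the interchange law). Rewriting. A diagram rewriting system is a signature together with a set of rules $\phi\to\phi'$ between diagrams with the same numbers of inputs and outputs; a one-step rewriting is $\chi_u;(1_k*\phi*1_l);\chi_d\ \to\ \chi_u;(1_k*\phi'*1_l);\chi_d$ for a rule $\phi\to\phi'$, $k,l\in\mathbb N$, and composable diagrams $\chi_u,\chi_d$. Write $\to^*$ for a finite (possibly empty) sequence of steps. The system terminates if there is no infinite rewriting sequence; it is confluent if whenever $\phi\to\phi_1$ and $\phi\to\phi_2$ there is $\phi'$ with $\phi_1\to^*\phi'$ and $\phi_2\to^*\phi'$; it is convergent if it terminates and is confluent. The system $\mathfrak F$. Its signature has the three gates $m:2\Rightarrow1$, $e:0\Rightarrow1$, $s:2\Rightarrow2$. Its rules are: (monoidal rules) $(m*1);m\to(1*m);m$; $\quad(e*1);m\to1$; $\quad(1*e);m\to1$; (braiding and parallel associativity) $s;m\to m$; $\quad(s*1);(1*m);m\to(1*m);m$; (structural rules) $s;s\to1_2$; $\quad(s*1);(1*s);(s*1)\to(1*s);(s*1);(1*s)$;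 $\quad(e*1);s\to1*e$; $\quad(1*e);s\to e*1$; $\quad(m*1);s\to(1*s);(s*1);(1*m)$; $\quad(s*1);(1*s);(m*1)\to(1*m);s$; $\quad(s*1);(1*m);s\to(1*s);(m*1)$. *)

theory Defs
  imports Main
begin

section \<open>Diagrams over a finite signature\<close>

class gates = finite +
  fixes gate_in :: "'a \<Rightarrow> nat"
    and gate_out :: "'a \<Rightarrow> nat"

datatype 'g dterm =
    TGate 'g
  | TId nat
  | TSeq "'g dterm" "'g dterm"
  | TPar "'g dterm" "'g dterm"

inductive tarity :: "'g::gates dterm \<Rightarrow> nat \<Rightarrow> nat \<Rightarrow> bool" where
  "tarity (TGate g) (gate_in g) (gate_out g)"
| "tarity (TId n) n n"
| "tarity t p q \<Longrightarrow> tarity u q r \<Longrightarrow> tarity (TSeq t u) p r"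
| "tarity t p q \<Longrightarrow> tarity u p' q' \<Longrightarrow> tarity (TPar t u) (p + p') (q + q')"

inductive_cases tarity_TIdE: "tarity (TId n) p q"
inductive_cases tarity_TSeqE: "tarity (TSeq t u) p q"
inductive_cases tarity_TParE: "tarity (TPar t u) p q"

lemma tarity_TId_iff: "tarity (TId n) p q \<longleftrightarrow> p = n \<and> q = n"
  by (auto elim: tarity_TIdE intro: tarity.intros)

lemma tarity_TSeq_iff: "tarity (TSeq t u) p q \<longleftrightarrow> (\<exists>r. tarity t p r \<and> tarity u r q)"
  by (auto elim: tarity_TSeqE intro: tarity.intros)

lemma tarity_TPar_iff:
  "tarity (TPar t u) p q \<longleftrightarrow>
    (\<exists>a b c d. p = a + c \<and> q = b + d \<and> tarity t a b \<and> tarity u c d)"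
  by (blast elim: tarity_TParE intro: tarity.intros)

lemma tarity_unique: "tarity t p q \<Longrightarrow> tarity t p' q' \<Longrightarrow> p' = p \<and> q' = q"
proof (induction arbitrary: p' q' rule: tarity.induct)
  case (1 g)
  then show ?case by (auto elim: tarity.cases)
next
  case (2 n)
  then show ?case by (simp add: tarity_TId_iff)
next
  case (3 t p q u r)
  from 3(5) show ?case by (rule tarity_TSeqE) (use 3(3,4) in blast)
next
  case (4 t p q u a b)
  from 4(5) show ?case by (rule tarity_TParE) (use 4(3,4) in blast)
qed

text \<open>
  The congruence generated by the axioms of a strict monoidal category.  It relates ill-typed
  terms as well, but it preserves arities (lemma \<open>deq_tarity\<close>); on the terms of arity
  \<open>p \<Rightarrow> q\<close> it is therefore the equality of morphisms from \<open>p\<close> to \<open>q\<close> in the free PRO.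
\<close>

inductive deq :: "'g::gates dterm \<Rightarrow> 'g dterm \<Rightarrow> bool" where
  deq_refl: "deq t t"
| deq_sym: "deq t u \<Longrightarrow> deq u t"
| deq_trans: "deq t u \<Longrightarrow> deq u v \<Longrightarrow> deq t v"
| deq_seq_cong: "deq t t' \<Longrightarrow> deq u u' \<Longrightarrow> deq (TSeq t u) (TSeq t' u')"
| deq_par_cong: "deq t t' \<Longrightarrow> deq u u' \<Longrightarrow> deq (TPar t u) (TPar t' u')"
| deq_seq_assoc: "deq (TSeq (TSeq t u) v) (TSeq t (TSeq u v))"
| deq_seq_id_left: "tarity t p q \<Longrightarrow> deq (TSeq (TId p) t) t"
| deq_seq_id_right: "tarity t p q \<Longrightarrow> deq (TSeq t (TId q)) t"
| deq_par_assoc: "deq (TPar (TPar t u) v) (TPar t (TPar u v))"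
| deq_par_unit_left: "deq (TPar (TId 0) t) t"
| deq_par_unit_right: "deq (TPar t (TId 0)) t"
| deq_par_id: "deq (TPar (TId m) (TId n)) (TId (m + n))"
| deq_interchange:
    "tarity t p q \<Longrightarrow> tarity u q r \<Longrightarrow> tarity t' p' q' \<Longrightarrow> tarity u' q' r' \<Longrightarrow>
      deq (TPar (TSeq t u) (TSeq t' u')) (TSeq (TPar t t') (TPar u u'))"

lemma deq_tarity: "deq t u \<Longrightarrow> tarity t p q \<longleftrightarrow> tarity u p q"
proof (induction arbitrary: p q rule: deq.induct)
  case (deq_par_assoc t u v)
  show ?case
  proof
    assume "tarity (TPar (TPar t u) v) p q"
    then obtain a b c d a' b' where "p = (a + c) + a'" "q = (b + d) + b'"
        "tarity t a b" "tarity u c d" "tarity v a' b'"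
      unfolding tarity_TPar_iff by blast
    then show "tarity (TPar t (TPar u v)) p q"
      by (auto simp: add.assoc intro!: tarity.intros)
  next
    assume "tarity (TPar t (TPar u v)) p q"
    then obtain a b c d a' b' where "p = (a + c) + a'" "q = (b + d) + b'"
        "tarity t a b" "tarity u c d" "tarity v a' b'"
      unfolding tarity_TPar_iff by (metis add.assoc)
    then show "tarity (TPar (TPar t u) v) p q"
      by (auto intro!: tarity.intros)
  qed
next
  case (deq_interchange t p0 q0 u r t' p' q' u' r')
  have l: "tarity (TPar (TSeq t u) (TSeq t' u')) (p0 + p') (r + r')"
   and r: "tarity (TSeq (TPar t t') (TPar u u')) (p0 + p') (r + r')"
    using deq_interchange by (auto intro: tarity.intros)
  show ?case using l r tarity_unique by blast
next
  case (deq_seq_id_left t p0 q0)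
  then show ?case by (auto simp: tarity_TSeq_iff tarity_TId_iff dest: tarity_unique)
next
  case (deq_seq_id_right t p0 q0)
  then show ?case by (auto simp: tarity_TSeq_iff tarity_TId_iff dest: tarity_unique)
next
  case (deq_par_unit_left t)
  show ?case
    unfolding tarity_TPar_iff tarity_TId_iff by (metis add_0)
next
  case (deq_par_unit_right t)
  show ?case
    unfolding tarity_TPar_iff tarity_TId_iff by (metis add_0_right)
qed (auto simp: tarity_TSeq_iff tarity_TPar_iff tarity_TId_iff)

lemma equivp_deq: "equivp deq"
  by (intro equivpI reflpI sympI transpI) (blast intro: deq.intros)+

quotient_type (overloaded) 'g diagram = "'g::gates dterm" / deq
  by (rule equivp_deq)

lift_definition gate :: "'g::gates \<Rightarrow> 'g diagram" is TGate .

lift_definition wires :: "nat \<Rightarrow> 'g::gates diagram" is TId .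

lift_definition dseq :: "'g::gates diagram \<Rightarrow> 'g diagram \<Rightarrow> 'g diagram" (infixr "\<Zsemi>" 65)
  is TSeq by (rule deq_seq_cong)

lift_definition dpar :: "'g::gates diagram \<Rightarrow> 'g diagram \<Rightarrow> 'g diagram" (infixr "\<otimes>" 70)
  is TPar by (rule deq_par_cong)

text \<open>
  The type \<^typ>\<open>'g diagram\<close> also contains classes of ill-typed terms; these have no arity.  The
  diagrams of the free PRO are the elements \<open>d\<close> with \<open>darity d p q\<close> for some \<open>p\<close> and \<open>q\<close>.
\<close>

lift_definition darity :: "'g::gates diagram \<Rightarrow> nat \<Rightarrow> nat \<Rightarrow> bool" is tarity
  by (intro ext) (rule deq_tarity)

lemma darity_intros:
  "darity (gate g) (gate_in g) (gate_out g)"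
  "darity (wires n) n n"
  "darity x p q \<Longrightarrow> darity y q r \<Longrightarrow> darity (x \<Zsemi> y) p r"
  "darity x p q \<Longrightarrow> darity y p' q' \<Longrightarrow> darity (x \<otimes> y) (p + p') (q + q')"
  by (transfer, blast intro: tarity.intros)+


section \<open>Diagram rewriting\<close>

inductive rewrite_step ::
    "('g::gates diagram \<times> 'g diagram) set \<Rightarrow> 'g diagram \<Rightarrow> 'g diagram \<Rightarrow> bool"
  for R where
  "(\<phi>, \<phi>') \<in> R \<Longrightarrow> darity \<phi> p q \<Longrightarrow> darity \<phi>' p q \<Longrightarrow>
    darity \<chi>u a (k + p + l) \<Longrightarrow> darity \<chi>d (k + q + l) b \<Longrightarrow>
    rewrite_step R (\<chi>u \<Zsemi> (wires k \<otimes> \<phi> \<otimes> wires l) \<Zsemi> \<chi>d)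
                   (\<chi>u \<Zsemi> (wires k \<otimes> \<phi>' \<otimes> wires l) \<Zsemi> \<chi>d)"

definition drs_terminates :: "('g::gates diagram \<times> 'g diagram) set \<Rightarrow> bool" where
  "drs_terminates R \<longleftrightarrow> \<not> (\<exists>f :: nat \<Rightarrow> 'g diagram. \<forall>i. rewrite_step R (f i) (f (Suc i)))"

text \<open>
  The peaks below are one-step peaks.  For terminating systems this agrees with joinability of
  arbitrary peaks, see lemma \<open>drs_convergent_iff\<close>.
\<close>

definition drs_confluent :: "('g::gates diagram \<times> 'g diagram) set \<Rightarrow> bool" where
  "drs_confluent R \<longleftrightarrow>
    (\<forall>\<phi> \<phi>1 \<phi>2. rewrite_step R \<phi> \<phi>1 \<longrightarrow> rewrite_step R \<phi> \<phi>2 \<longrightarrow>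
      (\<exists>\<phi>'. (rewrite_step R)\<^sup>*\<^sup>* \<phi>1 \<phi>' \<and> (rewrite_step R)\<^sup>*\<^sup>* \<phi>2 \<phi>'))"

definition drs_convergent :: "('g::gates diagram \<times> 'g diagram) set \<Rightarrow> bool" where
  "drs_convergent R \<longleftrightarrow> drs_terminates R \<and> drs_confluent R"

lemma drs_convergent_iff:
  "drs_convergent R \<longleftrightarrow> drs_terminates R \<and>
    (\<forall>\<phi> \<phi>1 \<phi>2. (rewrite_step R)\<^sup>*\<^sup>* \<phi> \<phi>1 \<longrightarrow> (rewrite_step R)\<^sup>*\<^sup>* \<phi> \<phi>2 \<longrightarrow>
      (\<exists>\<phi>'. (rewrite_step R)\<^sup>*\<^sup>* \<phi>1 \<phi>' \<and> (rewrite_step R)\<^sup>*\<^sup>* \<phi>2 \<phi>'))"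
  (is "_ \<longleftrightarrow> _ \<and> ?C")
proof
  assume *: "drs_convergent R"
  let ?s = "rewrite_step R"
  have "wfP (\<lambda>y x. ?s x y)"
    using * unfolding drs_convergent_def drs_terminates_def wfp_def wf_iff_no_infinite_down_chain
    by auto
  then have "?s\<^sup>*\<^sup>* \<phi> \<phi>1 \<longrightarrow> ?s\<^sup>*\<^sup>* \<phi> \<phi>2 \<longrightarrow> (\<exists>\<phi>'. ?s\<^sup>*\<^sup>* \<phi>1 \<phi>' \<and> ?s\<^sup>*\<^sup>* \<phi>2 \<phi>')" for \<phi> \<phi>1 \<phi>2
  proof (induction \<phi> arbitrary: \<phi>1 \<phi>2 rule: wfp_induct_rule)
    case (less x)
    show ?case
    proof (intro impI)
      assume 1: "?s\<^sup>*\<^sup>* x \<phi>1" and 2: "?s\<^sup>*\<^sup>* x \<phi>2"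
      show "\<exists>\<phi>'. ?s\<^sup>*\<^sup>* \<phi>1 \<phi>' \<and> ?s\<^sup>*\<^sup>* \<phi>2 \<phi>'"
      proof (cases "\<phi>1 = x \<or> \<phi>2 = x")
        case True
        then show ?thesis using 1 2 by auto
      next
        case False
        obtain y1 where y1: "?s x y1" "?s\<^sup>*\<^sup>* y1 \<phi>1"
          using 1 False by (metis converse_rtranclpE)
        obtain y2 where y2: "?s x y2" "?s\<^sup>*\<^sup>* y2 \<phi>2"
          using 2 False by (metis converse_rtranclpE)
        obtain z where z: "?s\<^sup>*\<^sup>* y1 z" "?s\<^sup>*\<^sup>* y2 z"
          using * y1(1) y2(1) unfolding drs_convergent_def drs_confluent_def by blast
        obtain w where w: "?s\<^sup>*\<^sup>* \<phi>1 w" "?s\<^sup>*\<^sup>* z w"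
          using less[OF y1(1)] y1(2) z(1) by blast
        obtain v where v: "?s\<^sup>*\<^sup>* w v" "?s\<^sup>*\<^sup>* \<phi>2 v"
          using less[OF y2(1)] y2(2) rtranclp_trans[OF z(2) w(2)] by blast
        show ?thesis using rtranclp_trans[OF w(1) v(1)] v(2) by blast
      qed
    qed
  qed
  then show "drs_terminates R \<and> ?C"
    using * unfolding drs_convergent_def by blast
next
  assume "drs_terminates R \<and> ?C"
  then show "drs_convergent R"
    unfolding drs_convergent_def drs_confluent_def by (meson r_into_rtranclp)
qed


section \<open>The system \<open>\<FF>\<close>\<close>

datatype F_gate = F_m | F_e | F_s

instantiation F_gate :: gates
begin

fun gate_in_F_gate :: "F_gate \<Rightarrow> nat" where
  "gate_in_F_gate F_m = 2"
| "gate_in_F_gate F_e = 0"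
| "gate_in_F_gate F_s = 2"

fun gate_out_F_gate :: "F_gate \<Rightarrow> nat" where
  "gate_out_F_gate F_m = 1"
| "gate_out_F_gate F_e = 1"
| "gate_out_F_gate F_s = 2"

instance
proof
  have "(UNIV :: F_gate set) \<subseteq> {F_m, F_e, F_s}"
    by (auto intro: F_gate.exhaust)
  then show "finite (UNIV :: F_gate set)"
    by (rule finite_subset) simp
qed

end

definition F_rules :: "(F_gate diagram \<times> F_gate diagram) set" where
  "F_rules = (let m = gate F_m; e = gate F_e; s = gate F_s; i = wires 1 in
    { \<comment> \<open>monoidal rules\<close>
      ((m \<otimes> i) \<Zsemi> m, (i \<otimes> m) \<Zsemi> m),
      ((e \<otimes> i) \<Zsemi> m, i),
      ((i \<otimes> e) \<Zsemi> m, i),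
      \<comment> \<open>braiding and parallel associativity\<close>
      (s \<Zsemi> m, m),
      ((s \<otimes> i) \<Zsemi> (i \<otimes> m) \<Zsemi> m, (i \<otimes> m) \<Zsemi> m),
      \<comment> \<open>structural rules\<close>
      (s \<Zsemi> s, wires 2),
      ((s \<otimes> i) \<Zsemi> (i \<otimes> s) \<Zsemi> (s \<otimes> i), (i \<otimes> s) \<Zsemi> (s \<otimes> i) \<Zsemi> (i \<otimes> s)),
      ((e \<otimes> i) \<Zsemi> s, i \<otimes> e),
      ((i \<otimes> e) \<Zsemi> s, e \<otimes> i),
      ((m \<otimes> i) \<Zsemi> s, (i \<otimes> s) \<Zsemi> (s \<otimes> i) \<Zsemi> (i \<otimes> m)),
      ((s \<otimes> i) \<Zsemi> (i \<otimes> s) \<Zsemi> (m \<otimes> i), (i \<otimes> m) \<Zsemi> s),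
      ((s \<otimes> i) \<Zsemi> (i \<otimes> m) \<Zsemi> s, (i \<otimes> s) \<Zsemi> (m \<otimes> i)) })"

lemma F_rules_same_arity:
  assumes "(\<phi>, \<phi>') \<in> F_rules"
  shows "\<exists>p q. darity \<phi> p q \<and> darity \<phi>' p q"
proof -
  have g: "darity (gate F_m) 2 1" "darity (gate F_e) 0 1" "darity (gate F_s) 2 2"
    "darity (wires 1 :: F_gate diagram) 1 1" "darity (wires 2 :: F_gate diagram) 2 2"
    using darity_intros(1)[of F_m] darity_intros(1)[of F_e] darity_intros(1)[of F_s]
    by (simp_all add: darity_intros(2))
  have par: "darity x p q \<Longrightarrow> darity y p' q' \<Longrightarrow> a = p + p' \<Longrightarrow> b = q + q' \<Longrightarrow> darity (x \<otimes> y) a b"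
    for x y :: "F_gate diagram" and p q p' q' a b
    by (simp add: darity_intros(4))
  have g2:
    "darity (gate F_m \<otimes> wires 1) 3 2" "darity (wires 1 \<otimes> gate F_m) 3 2"
    "darity (gate F_e \<otimes> wires 1) 1 2" "darity (wires 1 \<otimes> gate F_e) 1 2"
    "darity (gate F_s \<otimes> wires 1) 3 3" "darity (wires 1 \<otimes> gate F_s) 3 3"
    by (rule par, rule g, rule g, simp, simp)+
  show ?thesis
    using assms unfolding F_rules_def Let_def insert_iff empty_iff prod.inject
    apply -
    apply (elim disjE conjE FalseE)
    apply (hypsubst, ((rule exI)+, rule conjI, (rule g g2 darity_intros(3))+))+
    done
qed

end

theory Submission imports Defs begin

text \<open>
  Termination: interpret \<open>m\<close> by addition of positive weights and let \<open>s\<close>, crossing weights \<open>x\<close> and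
  \<open>y\<close>, cost \<open>x\<^sup>2(y + 1)\<close>; this is superadditive in \<open>x\<close> and strictly subadditive in \<open>y\<close>, which
  decides the two rules that move \<open>m\<close> through \<open>s\<close> in opposite directions.  All rules but the
  Yang-Baxter rule decrease this cost, and that rule preserves it and decreases a second one.

  Confluence: a diagram denotes a map from its inputs to its outputs, and rewriting preserves this
  map.  Every diagram reduces to a canonical one, in which the inputs are inserted from right to
  left, each crossing some strings and then possibly merging with the next, before all units are
  created at the bottom.  A canonical diagram is determined by the map it denotes, so all reducts
  of a diagram reach the same canonical diagram.
\<close>

section \<open>Words of elementary layers\<close>

text \<open>Diagrams are classes of terms, so no redex can be read off a diagram directly, and
  modulo interchange two overlapping redexes may enclose an arbitrary third diagram. For this reason
  neither half of the proof enumerates critical pairs. Reductions are found on words of layers,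
  where interchange becomes an explicit move that may be made in both directions; costs and fibres
  are attached to the diagrams themselves, so these moves cannot affect them. A cost that reads only
  the two weights meeting at a crossing cannot decide the Yang-Baxter rule, because both sides cross
  the same three pairs of strings, each once. The second cost escapes this by letting a crossing
  change the value on one of its strings, so that it notices the order of the crossings.\<close>

lemma dseq_assoc: "(x \<Zsemi> y) \<Zsemi> z = x \<Zsemi> (y \<Zsemi> z)"
  by transfer (rule deq_seq_assoc)

lemma dseq_wires_left: "darity x p q \<Longrightarrow> wires p \<Zsemi> x = x"
  by transfer (rule deq_seq_id_left)

lemma dseq_wires_right: "darity x p q \<Longrightarrow> x \<Zsemi> wires q = x"
  by transfer (rule deq_seq_id_right)

lemma dpar_assoc: "(x \<otimes> y) \<otimes> z = x \<otimes> (y \<otimes> z)"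
  by transfer (rule deq_par_assoc)

lemma dpar_wires_0: "wires 0 \<otimes> x = x" "x \<otimes> wires 0 = x"
  by (transfer, rule deq_par_unit_left) (transfer, rule deq_par_unit_right)

lemma wires_dpar_wires: "wires m \<otimes> wires n = wires (m + n)"
  by transfer (rule deq_par_id)

lemma dpar_dseq:
  "darity x p q \<Longrightarrow> darity y q r \<Longrightarrow> darity x' p' q' \<Longrightarrow> darity y' q' r' \<Longrightarrow>
    (x \<Zsemi> y) \<otimes> (x' \<Zsemi> y') = (x \<otimes> x') \<Zsemi> (y \<otimes> y')"
  by transfer (rule deq_interchange)

lemma dpar_arityI:
  "darity x p q \<Longrightarrow> darity y p' q' \<Longrightarrow> a = p + p' \<Longrightarrow> b = q + q' \<Longrightarrow> darity (x \<otimes> y) a b"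
  by (simp add: darity_intros(4))

lemma layer_arity:
  "a = k + gate_in g + l \<Longrightarrow> b = k + gate_out g + l \<Longrightarrow> darity (wires k \<otimes> gate g \<otimes> wires l) a b"
  by (rule dpar_arityI, rule darity_intros, rule dpar_arityI, rule darity_intros, rule darity_intros)
    auto

lemma wires_dpar_dseq:
  assumes "darity x p q" "darity y q r"
  shows "wires a \<otimes> (x \<Zsemi> y) = (wires a \<otimes> x) \<Zsemi> (wires a \<otimes> y)"
  using dpar_dseq[OF darity_intros(2) darity_intros(2) assms, of a]
  by (simp add: dseq_wires_left[OF darity_intros(2)])

lemma dseq_dpar_wires:
  assumes "darity x p q" "darity y q r"
  shows "(x \<Zsemi> y) \<otimes> wires a = (x \<otimes> wires a) \<Zsemi> (y \<otimes> wires a)"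
  using dpar_dseq[OF assms darity_intros(2) darity_intros(2), of a]
  by (simp add: dseq_wires_left[OF darity_intros(2)])

lemma dpar_eq_dseq:
  assumes "darity x p q" "darity y p' q'"
  shows "x \<otimes> y = (x \<otimes> wires p') \<Zsemi> (wires q \<otimes> y)"
    and "x \<otimes> y = (wires p \<otimes> y) \<Zsemi> (x \<otimes> wires q')"
  using dpar_dseq[OF assms(1) darity_intros(2) darity_intros(2) assms(2)]
    dpar_dseq[OF darity_intros(2) assms(1) assms(2) darity_intros(2)]
  by (simp_all add: dseq_wires_left[OF assms(1)] dseq_wires_left[OF assms(2)]
      dseq_wires_right[OF assms(1)] dseq_wires_right[OF assms(2)])

text \<open>
  The letter \<open>(k, g)\<close> stands for the layer \<open>1\<^sub>k * g * 1\<^sub>l\<close>, where \<open>l\<close> is determined by the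
  number of strings entering the layer.
\<close>

type_synonym 'g word = "(nat \<times> 'g) list"

text \<open>A word does not carry its width and is read relative to a number \<open>p\<close> of
  incoming strings. The subtractions are truncated, so the layers are the intended ones only when
  \<open>valid\<close> holds.\<close>

fun wdiag :: "nat \<Rightarrow> 'g::gates word \<Rightarrow> 'g diagram" where
  "wdiag p [] = wires p"
| "wdiag p ((k, g) # w) =
    (wires k \<otimes> gate g \<otimes> wires (p - k - gate_in g)) \<Zsemi> wdiag (p - gate_in g + gate_out g) w"

fun valid :: "nat \<Rightarrow> 'g::gates word \<Rightarrow> nat \<Rightarrow> bool" where
  "valid p [] q \<longleftrightarrow> p = q"
| "valid p ((k, g) # w) q \<longleftrightarrow> k + gate_in g \<le> p \<and> valid (p - gate_in g + gate_out g) w q"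

definition shift :: "nat \<Rightarrow> 'g word \<Rightarrow> 'g word" where
  "shift k w = map (\<lambda>(i, g). (k + i, g)) w"

lemma shift_simps [simp]:
  "shift k [] = []"
  "shift k ((i, g) # w) = (k + i, g) # shift k w"
  "shift k (v @ w) = shift k v @ shift k w"
  "shift k w = [] \<longleftrightarrow> w = []"
  by (simp_all add: shift_def)

lemma shift_shift [simp]: "shift k (shift l w) = shift (k + l) w"
  by (auto simp: shift_def)

lemma shift_0 [simp]: "shift 0 w = w"
  by (auto simp: shift_def)

lemma wdiag_arity: "valid p w q \<Longrightarrow> darity (wdiag p w) p q"
proof (induction w arbitrary: p)
  case (Cons l w)
  obtain k g where l: "l = (k, g)" by (cases l)
  have "darity (wires k \<otimes> gate g \<otimes> wires (p - k - gate_in g)) p (p - gate_in g + gate_out g)"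
    using Cons.prems l by (intro layer_arity) auto
  then show ?case
    using Cons l by (auto intro: darity_intros(3))
qed (auto intro: darity_intros)

lemma valid_append: "valid p (v @ w) r \<longleftrightarrow> (\<exists>q. valid p v q \<and> valid q w r)"
  by (induction p v r rule: valid.induct) auto

lemma valid_unique: "valid p w q \<Longrightarrow> valid p w q' \<Longrightarrow> q = q'"
  by (induction p w q rule: valid.induct) auto

lemma valid_shift: "valid p w q \<Longrightarrow> valid (k + p) (shift k w) (k + q)"
proof (induction p w q rule: valid.induct)
  case (2 p i g w q)
  then have "k + p - gate_in g + gate_out g = k + (p - gate_in g + gate_out g)" by simp
  then show ?case using 2 by (auto simp: add.assoc)
qed simp

lemma valid_widen: "valid p w q \<Longrightarrow> valid (p + l) w (q + l)"
  by (induction p w q rule: valid.induct) (auto simp: add.commute add.left_commute)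

lemma valid_Suc_shiftD: "valid (Suc p) (shift 1 w) q \<Longrightarrow> \<exists>q'. q = Suc q' \<and> valid p w q'"
proof (induction w arbitrary: p)
  case (Cons l w)
  obtain k g where l: "l = (k, g)" by (cases l)
  have "Suc p - gate_in g + gate_out g = Suc (p - gate_in g + gate_out g)"
    using Cons.prems l by auto
  then show ?case using Cons.prems Cons.IH l by auto
qed auto

lemma wdiag_append:
  "valid p v q \<Longrightarrow> valid q w r \<Longrightarrow> wdiag p (v @ w) = wdiag p v \<Zsemi> wdiag q w"
proof (induction v arbitrary: p)
  case Nil
  then show ?case by (auto simp: dseq_wires_left[OF wdiag_arity])
next
  case (Cons l v)
  then show ?case by (cases l) (auto simp: dseq_assoc)
qed

lemma wdiag_append3:
  assumes "valid p a r" "valid r u r'" "valid r' b q"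
  shows "valid p (a @ u @ b) q"
    and "wdiag p (a @ u @ b) = wdiag p a \<Zsemi> wdiag r u \<Zsemi> wdiag r' b"
proof -
  have u: "valid r (u @ b) q" using assms by (auto simp: valid_append)
  show "valid p (a @ u @ b) q" using assms(1) u by (auto simp: valid_append)
  show "wdiag p (a @ u @ b) = wdiag p a \<Zsemi> wdiag r u \<Zsemi> wdiag r' b"
    using wdiag_append[OF assms(1) u] wdiag_append[OF assms(2,3)] by simp
qed

lemma wires_dpar_wdiag: "valid p w q \<Longrightarrow> wires a \<otimes> wdiag p w = wdiag (a + p) (shift a w)"
proof (induction w arbitrary: p)
  case Nil
  then show ?case by (simp add: wires_dpar_wires)
next
  case (Cons l w)
  obtain k g where l: "l = (k, g)" by (cases l)
  let ?p = "p - gate_in g + gate_out g"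
  have v: "valid ?p w q" "k + gate_in g \<le> p" using Cons.prems l by auto
  have "a + p - gate_in g + gate_out g = a + ?p" using v by auto
  moreover have "darity (wires k \<otimes> gate g \<otimes> wires (p - k - gate_in g)) p ?p"
    using v by (intro layer_arity) auto
  ultimately show ?case
    using Cons.IH[OF v(1)] v
    by (simp add: l wires_dpar_dseq[OF _ wdiag_arity] dpar_assoc[symmetric] wires_dpar_wires)
qed

lemma wdiag_dpar_wires: "valid p w q \<Longrightarrow> wdiag p w \<otimes> wires b = wdiag (p + b) w"
proof (induction w arbitrary: p)
  case Nil
  then show ?case by (simp add: wires_dpar_wires)
next
  case (Cons l w)
  obtain k g where l: "l = (k, g)" by (cases l)
  let ?p = "p - gate_in g + gate_out g"
  have v: "valid ?p w q" "k + gate_in g \<le> p" using Cons.prems l by auto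
  have "p + b - gate_in g + gate_out g = ?p + b" using v by auto
  moreover have "darity (wires k \<otimes> gate g \<otimes> wires (p - k - gate_in g)) p ?p"
    using v by (intro layer_arity) auto
  ultimately show ?case
    using Cons.IH[OF v(1)] v
    by (simp add: l dseq_dpar_wires[OF _ wdiag_arity] dpar_assoc wires_dpar_wires)
qed

lemma wdiag_context:
  assumes "valid n u m"
  shows "wdiag (k + n + l) (shift k u) = wires k \<otimes> wdiag n u \<otimes> wires l"
proof -
  have "wires k \<otimes> wdiag (n + l) u = wdiag (k + (n + l)) (shift k u)"
    by (rule wires_dpar_wdiag[OF valid_widen[OF assms]])
  then show ?thesis by (simp add: wdiag_dpar_wires[OF assms] add.assoc)
qed

text \<open>Both words slice the same product \<open>?x \<otimes> ?y\<close>, since \<open>h\<close>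
  lies wholly to the right of the outputs of \<open>g\<close>. The offset of \<open>h\<close> counts
  the outputs of \<open>g\<close> when \<open>g\<close> comes first, and its inputs when
  \<open>g\<close> comes second.\<close>

lemma wdiag_interchange:
  assumes "valid p [(k, g), (j, h)] q" "k + gate_out g \<le> j"
  shows "wdiag p [(k, g), (j, h)] = wdiag p [(j - gate_out g + gate_in g, h), (k, g)]"
proof -
  define a where "a = j - k - gate_out g"
  define l where "l = p - k - gate_in g - a - gate_in h"
  have j: "j = k + gate_out g + a" using assms by (simp add: a_def)
  have p: "p = k + gate_in g + a + gate_in h + l" using assms by (auto simp: l_def a_def)
  let ?x = "wires k \<otimes> gate g" and ?y = "wires a \<otimes> gate h \<otimes> wires l"
  have x: "darity ?x (k + gate_in g) (k + gate_out g)"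
    by (intro darity_intros)
  have y: "darity ?y (a + gate_in h + l) (a + gate_out h + l)"
    by (rule layer_arity) simp_all
  have merge: "wires b \<otimes> wires c \<otimes> z = wires (b + c) \<otimes> z" for b c and z :: "'a diagram"
    by (simp add: dpar_assoc[symmetric] wires_dpar_wires)
  note layer_id = dseq_wires_right[OF layer_arity[OF refl]]
  have "wdiag p [(k, g), (j, h)] = ?x \<otimes> ?y"
    unfolding dpar_eq_dseq(1)[OF x y]
    by (simp add: p j layer_id dpar_assoc merge add.assoc)
  also have "\<dots> = wdiag p [(j - gate_out g + gate_in g, h), (k, g)]"
    unfolding dpar_eq_dseq(2)[OF x y]
    by (simp add: p j layer_id dpar_assoc merge ac_simps)
  finally show ?thesis .
qed


section \<open>Evaluation of diagrams\<close>

text \<open>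
  A gate \<open>g\<close> transforms the list of values on its inputs by \<open>J g\<close>, at cost \<open>C g\<close>.  Evaluation is
  a relation, so that it respects the axioms on ill-typed terms as well.
\<close>

primrec trun :: "('g::gates \<Rightarrow> 'v list \<Rightarrow> 'v list) \<Rightarrow> ('g \<Rightarrow> 'v list \<Rightarrow> nat) \<Rightarrow>
    'g dterm \<Rightarrow> 'v list \<Rightarrow> 'v list \<Rightarrow> nat \<Rightarrow> bool" where
  "trun J C (TGate g) xs ys c \<longleftrightarrow>
    length xs = gate_in g \<and> length ys = gate_out g \<and> ys = J g xs \<and> c = C g xs"
| "trun J C (TId n) xs ys c \<longleftrightarrow> length xs = n \<and> ys = xs \<and> c = 0"
| "trun J C (TSeq t u) xs zs c \<longleftrightarrow>
    (\<exists>ys a b. trun J C t xs ys a \<and> trun J C u ys zs b \<and> c = a + b)"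
| "trun J C (TPar t u) xs ys c \<longleftrightarrow>
    (\<exists>xs1 xs2 ys1 ys2 a b. trun J C t xs1 ys1 a \<and> trun J C u xs2 ys2 b \<and>
      xs = xs1 @ xs2 \<and> ys = ys1 @ ys2 \<and> c = a + b)"

lemma trun_TSeqI: "trun J C t xs ys a \<Longrightarrow> trun J C u ys zs b \<Longrightarrow> trun J C (TSeq t u) xs zs (a + b)"
  unfolding trun.simps by blast

lemma trun_TParI: "trun J C t xs ys a \<Longrightarrow> trun J C u xs' ys' b \<Longrightarrow>
    trun J C (TPar t u) (xs @ xs') (ys @ ys') (a + b)"
  unfolding trun.simps by blast

lemma trun_length:
  "tarity t p q \<Longrightarrow> trun J C t xs ys c \<Longrightarrow> length xs = p \<and> length ys = q"
proof (induction arbitrary: xs ys c rule: tarity.induct)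
  case (3 t p q u r)
  from 3(5) obtain zs a b where "trun J C t xs zs a" "trun J C u zs ys b" by auto
  then show ?case using 3(3,4) by blast
next
  case (4 t p q u p' q')
  from 4(5) obtain xs1 xs2 ys1 ys2 a b where "trun J C t xs1 ys1 a" "trun J C u xs2 ys2 b"
    "xs = xs1 @ xs2" "ys = ys1 @ ys2" by auto
  then show ?case using 4(3,4) by force
qed auto

lemma deq_trun: "deq t u \<Longrightarrow> trun J C t xs ys c \<longleftrightarrow> trun J C u xs ys c"
proof (induction arbitrary: xs ys c rule: deq.induct)
  case (deq_seq_assoc t u v)
  show ?case
  proof
    assume "trun J C (TSeq (TSeq t u) v) xs ys c"
    then obtain zs zs' a b d where
      *: "trun J C t xs zs a" "trun J C u zs zs' b" "trun J C v zs' ys d" and c: "c = a + (b + d)"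
      by auto
    show "trun J C (TSeq t (TSeq u v)) xs ys c"
      unfolding c by (rule trun_TSeqI[OF *(1) trun_TSeqI[OF *(2,3)]])
  next
    assume "trun J C (TSeq t (TSeq u v)) xs ys c"
    then obtain zs zs' a b d where
      *: "trun J C t xs zs a" "trun J C u zs zs' b" "trun J C v zs' ys d" and c: "c = (a + b) + d"
      by auto
    show "trun J C (TSeq (TSeq t u) v) xs ys c"
      unfolding c by (rule trun_TSeqI[OF trun_TSeqI[OF *(1,2)] *(3)])
  qed
next
  case (deq_par_assoc t u v)
  show ?case
  proof
    assume "trun J C (TPar (TPar t u) v) xs ys c"
    then obtain xs1 xs2 xs3 ys1 ys2 ys3 a b d where
      *: "trun J C t xs1 ys1 a" "trun J C u xs2 ys2 b" "trun J C v xs3 ys3 d" and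
      eqs: "xs = xs1 @ (xs2 @ xs3)" "ys = ys1 @ (ys2 @ ys3)" "c = a + (b + d)"
      by auto
    show "trun J C (TPar t (TPar u v)) xs ys c"
      unfolding eqs by (rule trun_TParI[OF *(1) trun_TParI[OF *(2,3)]])
  next
    assume "trun J C (TPar t (TPar u v)) xs ys c"
    then obtain xs1 xs2 xs3 ys1 ys2 ys3 a b d where
      *: "trun J C t xs1 ys1 a" "trun J C u xs2 ys2 b" "trun J C v xs3 ys3 d" and
      eqs: "xs = (xs1 @ xs2) @ xs3" "ys = (ys1 @ ys2) @ ys3" "c = (a + b) + d"
      by auto
    show "trun J C (TPar (TPar t u) v) xs ys c"
      unfolding eqs by (rule trun_TParI[OF trun_TParI[OF *(1,2)] *(3)])
  qed
next
  case (deq_seq_id_left t p q)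
  then show ?case by (auto dest: trun_length)
next
  case (deq_seq_id_right t p q)
  then show ?case by (auto dest: trun_length)
next
  case (deq_par_id m n)
  show ?case
  proof
    assume *: "trun J C (TId (m + n)) xs ys c"
    have "trun J C (TPar (TId m) (TId n)) (take m xs @ drop m xs) (take m xs @ drop m xs) (0 + 0)"
      using * by (intro trun_TParI) auto
    then show "trun J C (TPar (TId m) (TId n)) xs ys c" using * by simp
  qed auto
next
  case (deq_interchange t p q u r t' p' q' u' r')
  show ?case
  proof
    assume "trun J C (TPar (TSeq t u) (TSeq t' u')) xs ys c"
    then obtain xs1 xs2 zs1 zs2 ys1 ys2 a b a' b' where
      *: "trun J C t xs1 zs1 a" "trun J C u zs1 ys1 b" "trun J C t' xs2 zs2 a'" "trun J C u' zs2 ys2 b'"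
      "xs = xs1 @ xs2" "ys = ys1 @ ys2" "c = (a + b) + (a' + b')"
      by auto
    have "trun J C (TSeq (TPar t t') (TPar u u')) xs ys ((a + a') + (b + b'))"
      unfolding *(5,6) by (rule trun_TSeqI[OF trun_TParI[OF *(1,3)] trun_TParI[OF *(2,4)]])
    then show "trun J C (TSeq (TPar t t') (TPar u u')) xs ys c"
      by (simp add: *(7) ac_simps)
  next
    assume "trun J C (TSeq (TPar t t') (TPar u u')) xs ys c"
    then obtain xs1 xs2 zs1 zs2 zs1' zs2' ys1 ys2 a b a' b' where
      *: "trun J C t xs1 zs1 a" "trun J C u zs1' ys1 b" "trun J C t' xs2 zs2 a'"
      "trun J C u' zs2' ys2 b'" "zs1 @ zs2 = zs1' @ zs2'"
      "xs = xs1 @ xs2" "ys = ys1 @ ys2" "c = (a + a') + (b + b')"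
      by auto
    \<comment> \<open>The two splittings of the intermediate list agree only because of the arities;
      this is where the typing premises of the interchange axiom enter.\<close>
    have "length zs1 = length zs1'"
      using deq_interchange(1,2) *(1,2) by (metis trun_length)
    then have zs: "zs1' = zs1" "zs2' = zs2" using *(5) by simp_all
    have "trun J C (TPar (TSeq t u) (TSeq t' u')) xs ys ((a + b) + (a' + b'))"
      unfolding *(6,7)
      by (rule trun_TParI[OF trun_TSeqI[OF *(1) *(2)[unfolded zs]] trun_TSeqI[OF *(3) *(4)[unfolded zs]]])
    then show "trun J C (TPar (TSeq t u) (TSeq t' u')) xs ys c"
      by (simp add: *(8) ac_simps)
  qed
qed auto

lift_definition drun :: "('g::gates \<Rightarrow> 'v list \<Rightarrow> 'v list) \<Rightarrow> ('g \<Rightarrow> 'v list \<Rightarrow> nat) \<Rightarrow>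
    'g diagram \<Rightarrow> 'v list \<Rightarrow> 'v list \<Rightarrow> nat \<Rightarrow> bool" is trun
  by (intro ext) (rule deq_trun)

lemma drun_simps:
  "drun J C (gate g) xs ys c \<longleftrightarrow>
    length xs = gate_in g \<and> length ys = gate_out g \<and> ys = J g xs \<and> c = C g xs"
  "drun J C (wires n) xs ys c \<longleftrightarrow> length xs = n \<and> ys = xs \<and> c = 0"
  "drun J C (x \<Zsemi> y) xs ys c \<longleftrightarrow>
    (\<exists>zs a b. drun J C x xs zs a \<and> drun J C y zs ys b \<and> c = a + b)"
  "drun J C (x \<otimes> y) xs ys c \<longleftrightarrow>
    (\<exists>xs1 xs2 ys1 ys2 a b. drun J C x xs1 ys1 a \<and> drun J C y xs2 ys2 b \<and>
      xs = xs1 @ xs2 \<and> ys = ys1 @ ys2 \<and> c = a + b)"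
  by (transfer, simp)+

lemma drun_dparI: "drun J C x xs ys a \<Longrightarrow> drun J C y xs' ys' b \<Longrightarrow>
    drun J C (x \<otimes> y) (xs @ xs') (ys @ ys') (a + b)"
  by transfer (rule trun_TParI)

fun wval :: "('g::gates \<Rightarrow> 'v list \<Rightarrow> 'v list) \<Rightarrow> 'g word \<Rightarrow> 'v list \<Rightarrow> 'v list" where
  "wval J [] xs = xs"
| "wval J ((k, g) # w) xs =
    wval J w (take k xs @ J g (take (gate_in g) (drop k xs)) @ drop (k + gate_in g) xs)"

fun wcost :: "('g::gates \<Rightarrow> 'v list \<Rightarrow> 'v list) \<Rightarrow> ('g \<Rightarrow> 'v list \<Rightarrow> nat) \<Rightarrow>
    'g word \<Rightarrow> 'v list \<Rightarrow> nat" where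
  "wcost J C [] xs = 0"
| "wcost J C ((k, g) # w) xs = C g (take (gate_in g) (drop k xs)) +
    wcost J C w (take k xs @ J g (take (gate_in g) (drop k xs)) @ drop (k + gate_in g) xs)"

lemma wval_append: "wval J (v @ w) xs = wval J w (wval J v xs)"
  by (induction J v xs rule: wval.induct) auto

lemma wcost_append: "wcost J C (v @ w) xs = wcost J C v xs + wcost J C w (wval J v xs)"
  by (induction J C v xs rule: wcost.induct) auto

lemma wval_shift: "wval J (shift (length xs) w) (xs @ ys) = xs @ wval J w ys"
  by (induction J w ys rule: wval.induct) auto

lemma wval_shift_Cons: "wval J (shift (Suc 0) w) (x # ys) = x # wval J w ys"
  using wval_shift[of J "[x]"] by simp

lemma wcost_shift: "wcost J C (shift (length xs) w) (xs @ ys) = wcost J C w ys"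
  by (induction J C w ys rule: wcost.induct) auto

definition arity_respecting :: "('g::gates \<Rightarrow> 'v list \<Rightarrow> 'v list) \<Rightarrow> bool" where
  "arity_respecting J \<longleftrightarrow> (\<forall>g xs. length xs = gate_in g \<longrightarrow> length (J g xs) = gate_out g)"

lemma drun_layer:
  assumes "arity_respecting J"
  shows "drun J C (wires k \<otimes> gate g \<otimes> wires l) xs ys c \<longleftrightarrow> length xs = k + gate_in g + l \<and>
    ys = take k xs @ J g (take (gate_in g) (drop k xs)) @ drop (k + gate_in g) xs \<and>
    c = C g (take (gate_in g) (drop k xs))" (is "_ \<longleftrightarrow> ?r")
proof
  assume r: ?r
  let ?a = "take (gate_in g) (drop k xs)" and ?d = "drop (k + gate_in g) xs"
  have "drun J C (wires k \<otimes> gate g \<otimes> wires l) (take k xs @ ?a @ ?d) (take k xs @ J g ?a @ ?d)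
      (0 + (C g ?a + 0))"
    using r assms by (intro drun_dparI) (auto simp: drun_simps(1,2) arity_respecting_def)
  moreover have "take k xs @ ?a @ ?d = xs"
    by (metis add.commute append_take_drop_id drop_drop)
  ultimately show "drun J C (wires k \<otimes> gate g \<otimes> wires l) xs ys c"
    using r by simp
next
  assume "drun J C (wires k \<otimes> gate g \<otimes> wires l) xs ys c"
  then obtain xs1 xs2 xs3 where "length xs1 = k" "length xs2 = gate_in g" "length xs3 = l"
    "xs = xs1 @ xs2 @ xs3" "ys = xs1 @ J g xs2 @ xs3" "c = C g xs2"
    unfolding drun_simps by auto
  then show ?r by simp
qed

lemma drun_wdiag:
  assumes "arity_respecting J"
  shows "valid p w q \<Longrightarrow>
    drun J C (wdiag p w) xs ys c \<longleftrightarrow> length xs = p \<and> ys = wval J w xs \<and> c = wcost J C w xs"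
proof (induction w arbitrary: p xs c)
  case Nil
  then show ?case by (auto simp: drun_simps)
next
  case (Cons l w)
  obtain k g where l: "l = (k, g)" by (cases l)
  have "length (J g (take (gate_in g) (drop k xs))) = gate_out g" if "length xs = p"
    using that assms Cons.prems l by (auto simp: arity_respecting_def)
  then show ?case
    using Cons by (auto simp: l drun_simps(3) drun_layer[OF assms])
qed

lemma length_wval:
  assumes "arity_respecting J"
  shows "valid (length xs) w q \<Longrightarrow> length (wval J w xs) = q"
proof (induction w arbitrary: xs)
  case (Cons l w)
  obtain k g where l: "l = (k, g)" by (cases l)
  have "length (J g (take (gate_in g) (drop k xs))) = gate_out g"
    using assms Cons.prems l by (auto simp: arity_respecting_def)
  then show ?case
    using Cons by (auto simp: l add.commute)
qed auto

text \<open>Induction on a term for \<open>d\<close>. In the parallel case the left factor is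
  executed first, so the right one is shifted past the \<open>q\<close> outputs of the left.\<close>

lemma wdiag_exists:
  assumes "darity d p q"
  shows "\<exists>w. valid p w q \<and> wdiag p w = d"
proof -
  have "tarity t p q \<Longrightarrow> \<exists>w. valid p w q \<and> wdiag p w = abs_diagram t" for t
  proof (induction t p q rule: tarity.induct)
    case (1 g)
    have "wdiag (gate_in g) [(0, g)] = gate g"
      by (simp add: dpar_wires_0 dseq_wires_right[OF darity_intros(1)])
    then show ?case
      by (intro exI[of _ "[(0, g)]"]) (simp add: gate.abs_eq)
  next
    case (2 n)
    then show ?case by (intro exI[of _ "[]"]) (simp add: wires.abs_eq)
  next
    case (3 t p q u r)
    then obtain v w where "valid p v q" "wdiag p v = abs_diagram t" "valid q w r"
      "wdiag q w = abs_diagram u" by blast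
    then show ?case
      by (intro exI[of _ "v @ w"]) (auto simp: valid_append wdiag_append dseq.abs_eq)
  next
    case (4 t p q u p' q')
    then obtain v w where *: "valid p v q" "wdiag p v = abs_diagram t" "valid p' w q'"
      "wdiag p' w = abs_diagram u" by blast
    have v: "valid (p + p') v (q + p')" and w: "valid (q + p') (shift q w) (q + q')"
      using * by (simp_all add: valid_widen valid_shift)
    have "wdiag (p + p') (v @ shift q w) = wdiag p v \<otimes> wdiag p' w"
      using wdiag_append[OF v w] * wdiag_dpar_wires[OF *(1), of p'] wires_dpar_wdiag[OF *(3), of q]
        dpar_eq_dseq(1)[OF wdiag_arity[OF *(1)] wdiag_arity[OF *(3)]]
      by simp
    then show ?case
      using v w * by (intro exI[of _ "v @ shift q w"]) (auto simp: valid_append dpar.abs_eq)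
  qed
  moreover have "d = abs_diagram (rep_diagram d)"
    by (rule Quotient3_abs_rep[OF Quotient3_diagram, symmetric])
  ultimately show ?thesis using assms by (metis darity.abs_eq)
qed


section \<open>The rules of \<open>\<FF>\<close> on words\<close>

text \<open>The first component is the number of inputs. The words do not determine it: three
  right-hand sides are empty.\<close>

definition F_word_rules :: "(nat \<times> F_gate word \<times> F_gate word) set" where
  "F_word_rules = {
    (3, [(0, F_m), (0, F_m)], [(1, F_m), (0, F_m)]),
    (1, [(0, F_e), (0, F_m)], []),
    (1, [(1, F_e), (0, F_m)], []),
    (2, [(0, F_s), (0, F_m)], [(0, F_m)]),
    (3, [(0, F_s), (1, F_m), (0, F_m)], [(1, F_m), (0, F_m)]),
    (2, [(0, F_s), (0, F_s)], []),
    (3, [(0, F_s), (1, F_s), (0, F_s)], [(1, F_s), (0, F_s), (1, F_s)]),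
    (1, [(0, F_e), (0, F_s)], [(1, F_e)]),
    (1, [(1, F_e), (0, F_s)], [(0, F_e)]),
    (3, [(0, F_m), (0, F_s)], [(1, F_s), (0, F_s), (1, F_m)]),
    (3, [(0, F_s), (1, F_s), (0, F_m)], [(1, F_m), (0, F_s)]),
    (3, [(0, F_s), (1, F_m), (0, F_s)], [(1, F_s), (0, F_m)])}"

lemma F_word_rules_cases [consumes 1]:
  assumes "(n, u, v) \<in> F_word_rules"
  obtains "n = 3" "u = [(0, F_m), (0, F_m)]" "v = [(1, F_m), (0, F_m)]"
  | "n = 1" "u = [(0, F_e), (0, F_m)]" "v = []"
  | "n = 1" "u = [(1, F_e), (0, F_m)]" "v = []"
  | "n = 2" "u = [(0, F_s), (0, F_m)]" "v = [(0, F_m)]"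
  | "n = 3" "u = [(0, F_s), (1, F_m), (0, F_m)]" "v = [(1, F_m), (0, F_m)]"
  | "n = 2" "u = [(0, F_s), (0, F_s)]" "v = []"
  | "n = 3" "u = [(0, F_s), (1, F_s), (0, F_s)]" "v = [(1, F_s), (0, F_s), (1, F_s)]"
  | "n = 1" "u = [(0, F_e), (0, F_s)]" "v = [(1, F_e)]"
  | "n = 1" "u = [(1, F_e), (0, F_s)]" "v = [(0, F_e)]"
  | "n = 3" "u = [(0, F_m), (0, F_s)]" "v = [(1, F_s), (0, F_s), (1, F_m)]"
  | "n = 3" "u = [(0, F_s), (1, F_s), (0, F_m)]" "v = [(1, F_m), (0, F_s)]"
  | "n = 3" "u = [(0, F_s), (1, F_m), (0, F_s)]" "v = [(1, F_s), (0, F_m)]"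
  using assms unfolding F_word_rules_def insert_iff empty_iff prod.inject
  by (elim disjE conjE FalseE) (rule that; assumption)+

lemma F_rules_eq_image: "F_rules = (\<lambda>(n, u, v). (wdiag n u, wdiag n v)) ` F_word_rules"
proof -
  have gateI: "p = gate_in g \<Longrightarrow> q = gate_out g \<Longrightarrow> darity (gate g) p q"
    and wiresI: "p = n \<Longrightarrow> q = n \<Longrightarrow> darity (wires n) p q"
    for p q n and g :: F_gate
    by (simp_all add: darity_intros)
  have absorb:
    "gate F_m \<Zsemi> wires (Suc 0) = gate F_m"
    "gate F_s \<Zsemi> wires (Suc (Suc 0)) = gate F_s"
    "wires (Suc 0) \<otimes> gate F_e \<Zsemi> wires (Suc (Suc 0)) = wires (Suc 0) \<otimes> gate F_e"
    "gate F_e \<otimes> wires (Suc 0) \<Zsemi> wires (Suc (Suc 0)) = gate F_e \<otimes> wires (Suc 0)"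
    "wires (Suc 0) \<otimes> gate F_m \<Zsemi> wires (Suc (Suc 0)) = wires (Suc 0) \<otimes> gate F_m"
    "gate F_m \<otimes> wires (Suc 0) \<Zsemi> wires (Suc (Suc 0)) = gate F_m \<otimes> wires (Suc 0)"
    "wires (Suc 0) \<otimes> gate F_s \<Zsemi> wires (Suc (Suc (Suc 0))) = wires (Suc 0) \<otimes> gate F_s"
    "gate F_s \<otimes> wires (Suc 0) \<Zsemi> wires (Suc (Suc (Suc 0))) = gate F_s \<otimes> wires (Suc 0)"
    by (rule dseq_wires_right, (rule dpar_arityI gateI wiresI refl | simp)+)+
  show ?thesis
    unfolding F_rules_def F_word_rules_def Let_def
    by (simp add: dpar_wires_0 absorb numeral_2_eq_2 numeral_3_eq_3)
qed

lemma F_word_rules_valid: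
  assumes "(n, u, v) \<in> F_word_rules"
  shows "\<exists>m. valid n u m \<and> valid n v m"
  using assms by (cases rule: F_word_rules_cases) auto

text \<open>Each left-hand side touches all of its \<open>n\<close> inputs, so wherever it occurs in
  a valid word there is room for the whole rule. This allows \<open>wstep\<close> to ignore
  widths.\<close>

lemma F_word_rules_width:
  assumes "(n, u, v) \<in> F_word_rules" "valid p (shift k u) q"
  shows "k + n \<le> p"
  using assms by (cases rule: F_word_rules_cases) auto

text \<open>Reduction modulo the axioms: interchange moves leave the diagram unchanged and become
  empty reductions in \<open>wstep_valid\<close>, where widths are restored as well. Both directions
  are allowed because words serve to find a reduction, not to measure it.\<close>

inductive wstep :: "F_gate word \<Rightarrow> F_gate word \<Rightarrow> bool" where
  wstep_rule: "(n, u, v) \<in> F_word_rules \<Longrightarrow> wstep (a @ shift k u @ b) (a @ shift k v @ b)"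
| wstep_interchange: "k + gate_out g \<le> j \<Longrightarrow>
    wstep (a @ [(k, g), (j, h)] @ b) (a @ [(j - gate_out g + gate_in g, h), (k, g)] @ b)"
| wstep_interchange': "k + gate_out g \<le> j \<Longrightarrow>
    wstep (a @ [(j - gate_out g + gate_in g, h), (k, g)] @ b) (a @ [(k, g), (j, h)] @ b)"

abbreviation wred :: "F_gate word \<Rightarrow> F_gate word \<Rightarrow> bool" where
  "wred \<equiv> wstep\<^sup>*\<^sup>*"

lemma wstep_context: "wstep v w \<Longrightarrow> wstep (a @ v @ b) (a @ w @ b)"
proof (induction rule: wstep.induct)
  case (wstep_rule n u v a' k b')
  then show ?case using wstep.wstep_rule[of n u v "a @ a'" k "b' @ b"] by simp
next
  case (wstep_interchange k g j a' h b')
  then show ?case using wstep.wstep_interchange[of k g j "a @ a'" h "b' @ b"] by simp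
next
  case (wstep_interchange' k g j a' h b')
  then show ?case using wstep.wstep_interchange'[of k g j "a @ a'" h "b' @ b"] by simp
qed

lemma wstep_shift: "wstep v w \<Longrightarrow> wstep (shift l v) (shift l w)"
proof (induction rule: wstep.induct)
  case (wstep_rule n u v a k b)
  then show ?case using wstep.wstep_rule[of n u v "shift l a" "l + k" "shift l b"] by simp
next
  case (wstep_interchange k g j a h b)
  then show ?case
    using wstep.wstep_interchange[of "l + k" g "l + j" "shift l a" h "shift l b"]
    by (simp add: add.assoc)
next
  case (wstep_interchange' k g j a h b)
  then show ?case
    using wstep.wstep_interchange'[of "l + k" g "l + j" "shift l a" h "shift l b"]
    by (simp add: add.assoc)
qed

lemma wred_context: "wred v w \<Longrightarrow> wred (a @ v @ b) (a @ w @ b)"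
  by (induction rule: rtranclp_induct) (auto intro: rtranclp.rtrancl_into_rtrancl wstep_context)

lemma wred_append1: "wred v w \<Longrightarrow> wred (a @ v) (a @ w)"
  using wred_context[of v w a "[]"] by simp

lemma wred_append2: "wred v w \<Longrightarrow> wred (v @ b) (w @ b)"
  using wred_context[of v w "[]" b] by simp

lemma wred_Cons: "wred v w \<Longrightarrow> wred (l # v) (l # w)"
  using wred_append1[of v w "[l]"] by simp

lemma wred_shift: "wred v w \<Longrightarrow> wred (shift l v) (shift l w)"
  by (induction rule: rtranclp_induct) (auto intro: rtranclp.rtrancl_into_rtrancl wstep_shift)

lemma wstep_valid:
  assumes "wstep v w" "valid p v q"
  shows "valid p w q \<and> (rewrite_step F_rules)\<^sup>*\<^sup>* (wdiag p v) (wdiag p w)"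
  using assms
proof (induction rule: wstep.induct)
  case (wstep_rule n u v a k b)
  obtain r r' where a: "valid p a r" and u: "valid r (shift k u) r'" and b: "valid r' b q"
    using wstep_rule.prems by (auto simp: valid_append)
  obtain l where r: "r = k + n + l"
    using F_word_rules_width[OF wstep_rule.hyps u] by (metis le_iff_add)
  obtain m where m: "valid n u m" "valid n v m"
    using F_word_rules_valid[OF wstep_rule.hyps] by blast
  have vs: "valid r (shift k w) (k + m + l)" if "valid n w m" for w :: "F_gate word"
    unfolding r by (rule valid_widen[OF valid_shift[OF that]])
  then have r': "r' = k + m + l" using m(1) u valid_unique by blast
  have "(wdiag n u, wdiag n v) \<in> F_rules"
    using wstep_rule.hyps unfolding F_rules_eq_image by force
  then have "rewrite_step F_rules
      (wdiag p a \<Zsemi> (wires k \<otimes> wdiag n u \<otimes> wires l) \<Zsemi> wdiag r' b)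
      (wdiag p a \<Zsemi> (wires k \<otimes> wdiag n v \<otimes> wires l) \<Zsemi> wdiag r' b)"
    using wdiag_arity[OF m(1)] wdiag_arity[OF m(2)] wdiag_arity[OF a] wdiag_arity[OF b]
    unfolding r r' by (rule rewrite_step.intros)
  moreover have "wdiag p (a @ shift k w @ b) =
      wdiag p a \<Zsemi> (wires k \<otimes> wdiag n w \<otimes> wires l) \<Zsemi> wdiag r' b" if "valid n w m" for w
    using wdiag_append3(2)[OF a vs[OF that] b[unfolded r']] wdiag_context[OF that, of k l] r r'
    by simp
  moreover have "valid p (a @ shift k v @ b) q"
    using wdiag_append3(1)[OF a vs[OF m(2)] b[unfolded r']] .
  ultimately show ?case using m by auto
next
  case (wstep_interchange k g j a h b)
  then obtain r r' where a: "valid p a r" and u: "valid r [(k, g), (j, h)] r'" and b: "valid r' b q"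
    unfolding valid_append by blast
  have u': "valid r [(j - gate_out g + gate_in g, h), (k, g)] r'"
    using u wstep_interchange.hyps by auto
  show ?case
    unfolding wdiag_append3(2)[OF a u b] wdiag_append3(2)[OF a u' b]
      wdiag_interchange[OF u wstep_interchange.hyps]
    using wdiag_append3(1)[OF a u' b] by blast
next
  case (wstep_interchange' k g j a h b)
  then obtain r r' where a: "valid p a r" and b: "valid r' b q"
    and u: "valid r [(j - gate_out g + gate_in g, h), (k, g)] r'"
    unfolding valid_append by blast
  have u': "valid r [(k, g), (j, h)] r'"
    using u wstep_interchange'.hyps by auto
  show ?case
    unfolding wdiag_append3(2)[OF a u b] wdiag_append3(2)[OF a u' b]
      wdiag_interchange[OF u' wstep_interchange'.hyps]
    using wdiag_append3(1)[OF a u' b] by blast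
qed

lemma wred_valid:
  "wred v w \<Longrightarrow> valid p v q \<Longrightarrow>
    valid p w q \<and> (rewrite_step F_rules)\<^sup>*\<^sup>* (wdiag p v) (wdiag p w)"
  by (induction rule: rtranclp_induct) (blast dest: wstep_valid intro: rtranclp_trans)+

lemma darity_unique: "darity d p q \<Longrightarrow> darity d p' q' \<Longrightarrow> p' = p \<and> q' = q"
  by transfer (rule tarity_unique)

text \<open>The contexts of a step are arbitrary diagrams; \<open>wdiag_exists\<close> turns them
  into words \<open>a\<close> and \<open>b\<close>, so that the step becomes the replacement of one
  factor of a word.\<close>

lemma rewrite_step_wordE:
  assumes "rewrite_step F_rules d d'"
  obtains p q n u v a k b where "(n, u, v) \<in> F_word_rules"
    "valid p (a @ shift k u @ b) q" "valid p (a @ shift k v @ b) q"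
    "d = wdiag p (a @ shift k u @ b)" "d' = wdiag p (a @ shift k v @ b)"
  using assms
proof (cases rule: rewrite_step.cases)
  case (1 \<phi> \<phi>' p' q' x r k l y q)
  then obtain n u v where rule: "(n, u, v) \<in> F_word_rules"
    and eq: "\<phi> = wdiag n u" "\<phi>' = wdiag n v"
    unfolding F_rules_eq_image by auto
  obtain m where m: "valid n u m" "valid n v m"
    using F_word_rules_valid[OF rule] by blast
  have pq: "p' = n" "q' = m"
    using 1 darity_unique wdiag_arity[OF m(1)] unfolding eq by blast+
  obtain a where a: "valid r a (k + n + l)" "wdiag r a = x"
    using wdiag_exists 1 unfolding pq by blast
  obtain b where b: "valid (k + m + l) b q" "wdiag (k + m + l) b = y"
    using wdiag_exists 1 unfolding pq by blast
  have vs: "valid (k + n + l) (shift k w) (k + m + l)" if "valid n w m" for w :: "F_gate word"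
    by (rule valid_widen[OF valid_shift[OF that]])
  have "wdiag r (a @ shift k w @ b) = x \<Zsemi> (wires k \<otimes> wdiag n w \<otimes> wires l) \<Zsemi> y"
    if "valid n w m" for w
    using wdiag_append3(2)[OF a(1) vs[OF that] b(1)] wdiag_context[OF that, of k l] a(2) b(2)
    by simp
  then show thesis
    using that[OF rule wdiag_append3(1)[OF a(1) vs[OF m(1)] b(1)]
        wdiag_append3(1)[OF a(1) vs[OF m(2)] b(1)]] 1(1,2) m eq by simp
qed


section \<open>Evaluation around an occurrence of a rule\<close>

lemma wval_context:
  "k \<le> length (wval J a xs) \<Longrightarrow> wval J (a @ shift k u @ b) xs =
    wval J b (take k (wval J a xs) @ wval J u (drop k (wval J a xs)))"
  using wval_shift[of J "take k (wval J a xs)" u "drop k (wval J a xs)"]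
  by (simp add: wval_append min_absorb2)

lemma wcost_context:
  assumes "k \<le> length (wval J a xs)"
  shows "wcost J C (a @ shift k u @ b) xs = wcost J C a xs + wcost J C u (drop k (wval J a xs)) +
    wcost J C b (take k (wval J a xs) @ wval J u (drop k (wval J a xs)))"
  using wval_shift[of J "take k (wval J a xs)" u "drop k (wval J a xs)"] assms
    wcost_shift[of J C "take k (wval J a xs)" u "drop k (wval J a xs)"]
  by (simp add: wcost_append wval_append min_absorb2)

lemma rule_context_width:
  assumes "arity_respecting J" "(n, u, v) \<in> F_word_rules" "valid (length xs) (a @ shift k u @ b) q"
  shows "k + n \<le> length (wval J a xs)"
  using assms F_word_rules_width[OF assms(2)] length_wval[OF assms(1)]
  by (auto simp: valid_append)

lemma length_ge_Cons:
  "1 \<le> length zs \<Longrightarrow> \<exists>x r. zs = x # r"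
  "2 \<le> length zs \<Longrightarrow> \<exists>x y r. zs = x # y # r"
  "3 \<le> length zs \<Longrightarrow> \<exists>x y z r. zs = x # y # z # r"
  by (auto simp: numeral_2_eq_2 numeral_3_eq_3 Suc_le_length_iff)


text \<open>Evaluation simplifies only when the entries that a rule consumes are explicit. This case
  rule exposes exactly these, which turns each later fact about the rules into twelve symbolic
  computations.\<close>

lemma F_word_rules_on_lists:
  assumes "(n, u, v) \<in> F_word_rules" "n \<le> length zs"
    and "\<And>x y z r. P [(0, F_m), (0, F_m)] [(1, F_m), (0, F_m)] (x # y # z # r)"
    and "\<And>x r. P [(0, F_e), (0, F_m)] [] (x # r)"
    and "\<And>x r. P [(1, F_e), (0, F_m)] [] (x # r)"
    and "\<And>x y r. P [(0, F_s), (0, F_m)] [(0, F_m)] (x # y # r)"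
    and "\<And>x y z r. P [(0, F_s), (1, F_m), (0, F_m)] [(1, F_m), (0, F_m)] (x # y # z # r)"
    and "\<And>x y r. P [(0, F_s), (0, F_s)] [] (x # y # r)"
    and "\<And>x y z r. P [(0, F_s), (1, F_s), (0, F_s)] [(1, F_s), (0, F_s), (1, F_s)] (x # y # z # r)"
    and "\<And>x r. P [(0, F_e), (0, F_s)] [(1, F_e)] (x # r)"
    and "\<And>x r. P [(1, F_e), (0, F_s)] [(0, F_e)] (x # r)"
    and "\<And>x y z r. P [(0, F_m), (0, F_s)] [(1, F_s), (0, F_s), (1, F_m)] (x # y # z # r)"
    and "\<And>x y z r. P [(0, F_s), (1, F_s), (0, F_m)] [(1, F_m), (0, F_s)] (x # y # z # r)"
    and "\<And>x y z r. P [(0, F_s), (1, F_m), (0, F_s)] [(1, F_s), (0, F_m)] (x # y # z # r)"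
  shows "P u v zs"
proof -
  consider "n = 1" | "n = 2" | "n = 3"
    using assms(1) by (cases rule: F_word_rules_cases) auto
  then show ?thesis
  proof cases
    case 1
    then obtain x r where "zs = x # r" using assms(2) length_ge_Cons(1)[of zs] by auto
    with assms(1) 1 assms(3-) show ?thesis
      by (cases rule: F_word_rules_cases) simp_all
  next
    case 2
    then obtain x y r where "zs = x # y # r" using assms(2) length_ge_Cons(2)[of zs] by auto
    with assms(1) 2 assms(3-) show ?thesis
      by (cases rule: F_word_rules_cases) simp_all
  next
    case 3
    then obtain x y z r where "zs = x # y # z # r" using assms(2) length_ge_Cons(3)[of zs] by auto
    with assms(1) 3 assms(3-) show ?thesis
      by (cases rule: F_word_rules_cases) simp_all
  qed
qed


section \<open>Termination\<close>

text \<open>Steps relate diagrams, so the measure must not depend on a chosen word. The evaluation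
  relation descends to the quotient, and the diagram itself forces the number \<open>n\<close> of
  inputs.\<close>

definition cost :: "(F_gate \<Rightarrow> nat list \<Rightarrow> nat list) \<Rightarrow> (F_gate \<Rightarrow> nat list \<Rightarrow> nat) \<Rightarrow>
    F_gate diagram \<Rightarrow> nat" where
  "cost J C d = (THE c. \<exists>n ys. drun J C d (replicate n 0) ys c)"

lemma cost_wdiag:
  "arity_respecting J \<Longrightarrow> valid p w q \<Longrightarrow> cost J C (wdiag p w) = wcost J C w (replicate p 0)"
  unfolding cost_def by (rule the_equality) (auto simp: drun_wdiag)

text \<open>The value \<open>x\<close> stands for the weight \<open>x + 1\<close>, so that weights are positive.\<close>

fun weight_val :: "F_gate \<Rightarrow> nat list \<Rightarrow> nat list" where
  "weight_val F_m [x, y] = [x + y + 1]"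
| "weight_val F_e [] = [0]"
| "weight_val F_s [x, y] = [y, x]"
| "weight_val _ _ = []"

text \<open>In weights X = x + 1 and Y = y + 1 the costs are X for \<open>F_m\<close> and X^2 (Y +
  1) for \<open>F_s\<close>. The cost of \<open>F_m\<close> decides the associativity and unit
  rules, where no crossing occurs; it charges the left argument because associativity moves merges
  to the right.\<close>

fun weight_cost :: "F_gate \<Rightarrow> nat list \<Rightarrow> nat" where
  "weight_cost F_m [x, y] = x + 1"
| "weight_cost F_s [x, y] = (x + 1) * (x + 1) * (y + 2)"
| "weight_cost _ _ = 0"

text \<open>
  For the Yang-Baxter rule, on inputs \<open>x, y, z\<close> the costs are \<open>x + x + (y + 1)\<close> and
  \<open>y + x + x\<close>, with equal outputs.
\<close>

fun height_val :: "F_gate \<Rightarrow> nat list \<Rightarrow> nat list" where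
  "height_val F_m _ = [0]"
| "height_val F_e _ = [0]"
| "height_val F_s [x, y] = [y + 1, x]"
| "height_val _ _ = []"

fun height_cost :: "F_gate \<Rightarrow> nat list \<Rightarrow> nat" where
  "height_cost F_s [x, y] = x"
| "height_cost _ _ = 0"

lemma arity_respecting_weight: "arity_respecting weight_val"
  unfolding arity_respecting_def
proof (intro allI impI)
  fix g :: F_gate and xs :: "nat list"
  assume "length xs = gate_in g"
  then show "length (weight_val g xs) = gate_out g"
    by (cases g) (auto simp: numeral_2_eq_2 length_Suc_conv)
qed

lemma arity_respecting_height: "arity_respecting height_val"
  unfolding arity_respecting_def
proof (intro allI impI)
  fix g :: F_gate and xs :: "nat list"
  assume "length xs = gate_in g"
  then show "length (height_val g xs) = gate_out g"
    by (cases g) (auto simp: numeral_2_eq_2 length_Suc_conv)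
qed

lemma weight_gate_mono:
  assumes "list_all2 (\<le>) xs ys"
  shows "list_all2 (\<le>) (weight_val g xs) (weight_val g ys) \<and> weight_cost g xs \<le> weight_cost g ys"
proof (cases "length xs = gate_in g")
  case True
  then show ?thesis using assms
    by (cases g) (auto simp: numeral_2_eq_2 length_Suc_conv list_all2_Cons1
        intro!: add_mono mult_le_mono)
next
  case False
  then have l: "length ys \<noteq> gate_in g" using list_all2_lengthD[OF assms] by simp
  \<comment> \<open>Lists of the wrong length fall through to the default equations;
    \<open>xs\<close> and \<open>ys\<close> have equal length, so they do so together.\<close>
  have "weight_val g zs = [] \<and> weight_cost g zs = 0" if "length zs \<noteq> gate_in g" for zs
    using that by (cases "(g, zs)" rule: weight_val.cases) auto
  then show ?thesis using False l by simp
qed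

text \<open>The unit rules lower the output weight by one, so the word below the redex is run on
  smaller values after such a step; its cost must not grow.\<close>

lemma weight_mono:
  "list_all2 (\<le>) xs ys \<Longrightarrow>
    wcost weight_val weight_cost w xs \<le> wcost weight_val weight_cost w ys"
proof (induction w arbitrary: xs ys)
  case (Cons l w)
  obtain k g where l: "l = (k, g)" by (cases l)
  note * = list_all2_takeI[OF Cons.prems] list_all2_dropI[OF Cons.prems]
  show ?case
    unfolding l wcost.simps
    using weight_gate_mono[OF list_all2_takeI[OF *(2)]]
    by (intro add_mono Cons.IH list_all2_appendI *) auto
qed simp

definition yang_baxter :: "F_gate word" where
  "yang_baxter = [(0, F_s), (1, F_s), (0, F_s)]"

text \<open>On weights X, Y, Z the rule for (m*1);s gains 2XY(Z + 1), the cross term of (X + Y)^2,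
  and the rule for (s*1);(1*s);(m*1) gains X^2, one of the two summands 1 on its left-hand side.
  Associativity gains X.\<close>

lemma rule_weight:
  assumes "(n, u, v) \<in> F_word_rules" "n \<le> length zs" "u \<noteq> yang_baxter"
  shows "list_all2 (\<le>) (wval weight_val v zs) (wval weight_val u zs)"
    and "wcost weight_val weight_cost v zs < wcost weight_val weight_cost u zs"
proof -
  have refl: "list_all2 (\<le>) r r" for r :: "nat list" by (simp add: list_all2_refl)
  have "u \<noteq> yang_baxter \<longrightarrow> list_all2 (\<le>) (wval weight_val v zs) (wval weight_val u zs) \<and>
    wcost weight_val weight_cost v zs < wcost weight_val weight_cost u zs"
    by (rule F_word_rules_on_lists[OF assms(1,2)])
      (simp_all add: refl yang_baxter_def algebra_simps)
  then show "list_all2 (\<le>) (wval weight_val v zs) (wval weight_val u zs)"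
    and "wcost weight_val weight_cost v zs < wcost weight_val weight_cost u zs"
    using assms(3) by auto
qed

text \<open>Besides the strict decrease, the outputs must agree for both interpretations: the word
  below the redex then contributes equally before and after the step.\<close>

lemma rule_height:
  assumes "(n, yang_baxter, v) \<in> F_word_rules" "n \<le> length zs"
  shows "wval weight_val v zs = wval weight_val yang_baxter zs"
    and "wcost weight_val weight_cost v zs = wcost weight_val weight_cost yang_baxter zs"
    and "wval height_val v zs = wval height_val yang_baxter zs"
    and "wcost height_val height_cost v zs < wcost height_val height_cost yang_baxter zs"
proof -
  have v: "n = 3" "v = [(1, F_s), (0, F_s), (1, F_s)]"
    using assms(1) by (cases rule: F_word_rules_cases; simp add: yang_baxter_def)+
  obtain x y z r where zs: "zs = x # y # z # r"
    using assms(2) length_ge_Cons(3)[of zs] v(1) by auto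
  show "wval weight_val v zs = wval weight_val yang_baxter zs"
    "wcost weight_val weight_cost v zs = wcost weight_val weight_cost yang_baxter zs"
    "wval height_val v zs = wval height_val yang_baxter zs"
    "wcost height_val height_cost v zs < wcost height_val height_cost yang_baxter zs"
    unfolding zs v yang_baxter_def by simp_all
qed

lemma rewrite_step_cost:
  assumes "rewrite_step F_rules d d'"
  shows "((cost weight_val weight_cost d', cost height_val height_cost d'),
      (cost weight_val weight_cost d, cost height_val height_cost d)) \<in> less_than <*lex*> less_than"
  using assms
proof (cases rule: rewrite_step_wordE)
  case (1 p q n u v a k b)
  let ?xs = "replicate p (0 :: nat)"
  note cw = cost_wdiag[OF arity_respecting_weight] cost_wdiag[OF arity_respecting_height]
  note width = rule_context_width[OF _ 1(1), of _ ?xs a k b q]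
  have ww: "k + n \<le> length (wval weight_val a ?xs)" and hw: "k + n \<le> length (wval height_val a ?xs)"
    using width[OF arity_respecting_weight] width[OF arity_respecting_height] 1(2) by simp_all
  have kw: "k \<le> length (wval weight_val a ?xs)" and kh: "k \<le> length (wval height_val a ?xs)"
    using ww hw by auto
  note ctx = wcost_context[OF kw] wcost_context[OF kh]
  have nw: "n \<le> length (drop k (wval weight_val a ?xs))" and nh: "n \<le> length (drop k (wval height_val a ?xs))"
    using ww hw by auto
  show ?thesis
  proof (cases "u = yang_baxter")
    case True
    note w = rule_height[OF 1(1)[unfolded True] nw] and h = rule_height[OF 1(1)[unfolded True] nh]
    have "cost weight_val weight_cost d' = cost weight_val weight_cost d"
      unfolding 1(4,5) cw(1)[OF 1(2)] cw(1)[OF 1(3)] ctx(1)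
      unfolding True w(1,2) ..
    moreover have "cost height_val height_cost d' < cost height_val height_cost d"
      unfolding 1(4,5) cw(2)[OF 1(2)] cw(2)[OF 1(3)] ctx(2)
      unfolding True h(3) using h(4) by linarith
    ultimately show ?thesis by simp
  next
    case False
    let ?A = "wval weight_val a ?xs"
    have "wcost weight_val weight_cost b (take k ?A @ wval weight_val v (drop k ?A))
        \<le> wcost weight_val weight_cost b (take k ?A @ wval weight_val u (drop k ?A))"
      by (intro weight_mono list_all2_appendI rule_weight(1)[OF 1(1) nw False])
        (simp add: list_all2_refl)
    then have "cost weight_val weight_cost d' < cost weight_val weight_cost d"
      unfolding 1(4,5) cw(1)[OF 1(2)] cw(1)[OF 1(3)] ctx(1)
      using rule_weight(2)[OF 1(1) nw False] by linarith
    then show ?thesis by simp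
  qed
qed

lemma F_rules_terminates: "drs_terminates F_rules"
  unfolding drs_terminates_def
proof
  assume "\<exists>f. \<forall>i. rewrite_step F_rules (f i) (f (Suc i))"
  then obtain f where f: "\<And>i. rewrite_step F_rules (f i) (f (Suc i))" by blast
  let ?m = "\<lambda>i. (cost weight_val weight_cost (f i), cost height_val height_cost (f i))"
  have "wf (less_than <*lex*> less_than)" by auto
  moreover have "(?m (Suc i), ?m i) \<in> less_than <*lex*> less_than" for i
    by (rule rewrite_step_cost[OF f])
  ultimately show False
    by (meson wf_iff_no_infinite_down_chain)
qed


section \<open>Canonical words\<close>

lemma wred_rule: "(n, u, v) \<in> F_word_rules \<Longrightarrow> wred (u @ b) (v @ b)"
  using wstep_rule[of n u v "[]" 0 b] by auto

lemma wred_rules: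
  "wred ((0, F_m) # (0, F_m) # b) ((Suc 0, F_m) # (0, F_m) # b)"
  "wred ((0, F_e) # (0, F_m) # b) b"
  "wred ((Suc 0, F_e) # (0, F_m) # b) b"
  "wred ((0, F_s) # (0, F_m) # b) ((0, F_m) # b)"
  "wred ((0, F_s) # (Suc 0, F_m) # (0, F_m) # b) ((Suc 0, F_m) # (0, F_m) # b)"
  "wred ((0, F_s) # (0, F_s) # b) b"
  "wred ((0, F_s) # (Suc 0, F_s) # (0, F_s) # b) ((Suc 0, F_s) # (0, F_s) # (Suc 0, F_s) # b)"
  "wred ((0, F_e) # (0, F_s) # b) ((Suc 0, F_e) # b)"
  "wred ((Suc 0, F_e) # (0, F_s) # b) ((0, F_e) # b)"
  "wred ((0, F_m) # (0, F_s) # b) ((Suc 0, F_s) # (0, F_s) # (Suc 0, F_m) # b)"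
  "wred ((0, F_s) # (Suc 0, F_s) # (0, F_m) # b) ((Suc 0, F_m) # (0, F_s) # b)"
  "wred ((0, F_s) # (Suc 0, F_m) # (0, F_s) # b) ((Suc 0, F_s) # (0, F_m) # b)"
  using wred_rule[where b = b] unfolding F_word_rules_def insert_iff prod.inject One_nat_def
  by (metis append_Cons append_Nil)+

text \<open>Brings the letters of a redex next to each other: in the words below they are separated
  by words lying wholly to the right of the gate at the left border.\<close>

lemma wred_interchange:
  "wred ((0, g) # shift (gate_out g) w @ b) (shift (gate_in g) w @ (0, g) # b)"
  "wred (shift (gate_in g) w @ (0, g) # b) ((0, g) # shift (gate_out g) w @ b)"
proof (induction w)
  case (Cons l w)
  obtain i h where l: "l = (i, h)" by (cases l)
  {
    case 1
    have "wred ((0, g) # shift (gate_out g) (l # w) @ b)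
        ((gate_in g + i, h) # (0, g) # shift (gate_out g) w @ b)"
      using wstep_interchange[of 0 g "gate_out g + i" "[]" h "shift (gate_out g) w @ b"] l
      by (simp add: add.commute r_into_rtranclp)
    also have "wred \<dots> ((gate_in g + i, h) # shift (gate_in g) w @ (0, g) # b)"
      by (rule wred_Cons[OF Cons.IH(1)])
    finally show ?case using l by simp
  next
    case 2
    have "wred (shift (gate_in g) (l # w) @ (0, g) # b)
        ((gate_in g + i, h) # (0, g) # shift (gate_out g) w @ b)"
      using wred_Cons[OF Cons.IH(2)] l by simp
    also have "wred \<dots> ((0, g) # shift (gate_out g) (l # w) @ b)"
      using wstep_interchange'[of 0 g "gate_out g + i" "[]" h "shift (gate_out g) w @ b"] l
      by (simp add: add.commute r_into_rtranclp)
    finally show ?case .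
  }
qed auto

lemmas wred_interchange_m = wred_interchange[of F_m,
      simplified numeral_2_eq_2 gate_in_F_gate.simps gate_out_F_gate.simps One_nat_def]
  and wred_interchange_e = wred_interchange[of F_e,
      simplified gate_in_F_gate.simps gate_out_F_gate.simps One_nat_def shift_0]
  and wred_interchange_s = wred_interchange[of F_s,
      simplified numeral_2_eq_2 gate_in_F_gate.simps gate_out_F_gate.simps]

text \<open>
  \<open>opw t b\<close> moves the leftmost string across the \<open>b\<close> strings to its right and, if \<open>t\<close> holds,
  merges it with the next one.
\<close>

primrec opw :: "bool \<Rightarrow> nat \<Rightarrow> F_gate word" where
  "opw t 0 = (if t then [(0, F_m)] else [])"
| "opw t (Suc b) = (0, F_s) # shift (Suc 0) (opw t b)"

text \<open>A crossing on top of two insertions can be absorbed. If both insertions start with a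
  crossing, the Yang-Baxter rule splits off the string that both cross and leaves the same problem
  with \<open>a\<close> and \<open>b\<close> decreased. Otherwise one insertion is at its end, and a
  rule for s;s, s;m or a merge next to a crossing applies, unless the word already has the required
  form.\<close>

lemma wred_s_opw_opw:
  "\<exists>t1 b1 t2 a2. wred ((0, F_s) # shift (Suc 0) (opw t a) @ opw t' b)
    (shift (Suc 0) (opw t1 b1) @ opw t2 a2)"
proof (induction a arbitrary: b)
  case 0
  show ?case
  proof (cases b)
    case 0
    have "\<not> t \<Longrightarrow> \<not> t' \<Longrightarrow> ?thesis"
      using 0 by (intro exI[of _ False] exI[of _ 0] exI[of _ False] exI[of _ 1]) simp
    moreover have "\<not> t \<Longrightarrow> t' \<Longrightarrow> ?thesis"
      using 0 wred_rules(4)[of "[]"]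
      by (intro exI[of _ False] exI[of _ 0] exI[of _ True] exI[of _ 0]) simp
    moreover have "t \<Longrightarrow> \<not> t' \<Longrightarrow> ?thesis"
      using 0 by (intro exI[of _ False] exI[of _ 0] exI[of _ True] exI[of _ 1]) simp
    moreover have "t \<Longrightarrow> t' \<Longrightarrow> ?thesis"
      using 0 wred_rules(5)[of "[]"]
      by (intro exI[of _ True] exI[of _ 0] exI[of _ True] exI[of _ 0]) simp
    ultimately show ?thesis by blast
  next
    case (Suc b')
    show ?thesis
    proof (cases t)
      case True
      have "wred ((0, F_s) # shift (Suc 0) (opw t 0) @ opw t' b)
          ((Suc 0, F_s) # (0, F_m) # shift (Suc 0) (opw t' b'))"
        using wred_rules(12) True Suc by simp
      also have "wred \<dots> ((Suc 0, F_s) # shift (Suc (Suc 0)) (opw t' b') @ (0, F_m) # [])"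
        using wred_Cons[OF wred_interchange_m(1)[of _ "[]"]] by simp
      also have "\<dots> = shift (Suc 0) (opw t' b) @ opw True 0"
        using Suc by simp
      finally show ?thesis by blast
    next
      case False
      have "wred ((0, F_s) # shift (Suc 0) (opw t 0) @ opw t' b) (shift (Suc 0) (opw t' b'))"
        using wred_rules(6) False Suc by simp
      also have "\<dots> = shift (Suc 0) (opw t' b') @ opw False 0"
        by simp
      finally show ?thesis by blast
    qed
  qed
next
  case (Suc a)
  show ?case
  proof (cases b)
    case 0
    show ?thesis
    proof (cases t')
      case True
      have "wred ((0, F_s) # shift (Suc 0) (opw t (Suc a)) @ opw t' b)
          ((0, F_s) # (Suc 0, F_s) # (0, F_m) # shift (Suc 0) (opw t a))"
        using 0 True wred_Cons[OF wred_Cons[OF wred_interchange_m(2)[of "opw t a" "[]"]]] by simp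
      also have "wred \<dots> ((Suc 0, F_m) # (0, F_s) # shift (Suc 0) (opw t a))"
        by (rule wred_rules)
      also have "\<dots> = shift (Suc 0) (opw True 0) @ opw t (Suc a)" by simp
      finally show ?thesis by blast
    next
      case False
      have "(0, F_s) # shift (Suc 0) (opw t (Suc a)) @ opw t' b =
          shift (Suc 0) (opw False 0) @ opw t (Suc (Suc a))"
        using 0 False by simp
      then show ?thesis by (metis rtranclp.rtrancl_refl)
    qed
  next
    case (Suc b')
    obtain t1 b1 t2 a2 where IH: "wred ((0, F_s) # shift (Suc 0) (opw t a) @ opw t' b')
        (shift (Suc 0) (opw t1 b1) @ opw t2 a2)"
      using Suc.IH by blast
    have "wred ((0, F_s) # shift (Suc 0) (opw t (Suc a)) @ opw t' b)
        ((0, F_s) # (Suc 0, F_s) # (0, F_s) # shift (Suc (Suc 0)) (opw t a) @ shift (Suc 0) (opw t' b'))"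
      using wred_Cons[OF wred_Cons[OF wred_interchange_s(2)]] Suc by simp
    also have "wred \<dots> ((Suc 0, F_s) # (0, F_s) #
        shift (Suc 0) ((0, F_s) # shift (Suc 0) (opw t a) @ opw t' b'))"
      using wred_rules(7) by simp
    also have "wred \<dots> ((Suc 0, F_s) # (0, F_s) # shift (Suc 0) (shift (Suc 0) (opw t1 b1) @ opw t2 a2))"
      by (intro wred_Cons wred_shift IH)
    also have "wred \<dots> ((Suc 0, F_s) # shift (Suc (Suc 0)) (opw t1 b1) @ (0, F_s) #
        shift (Suc 0) (opw t2 a2))"
      using wred_Cons[OF wred_interchange_s(1)] by simp
    also have "\<dots> = shift (Suc 0) (opw t1 (Suc b1)) @ opw t2 (Suc a2)" by simp
    finally show ?thesis by blast
  qed
qed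

text \<open>Instead of being merged on top, the two strings descend separately: the right one is
  inserted as before, then the left one crosses the same \<open>b\<close> strings and merges with
  it. Rule (m*1);s drives the descent, and associativity is needed at its end when \<open>t\<close>
  holds.\<close>

lemma wred_m_opw: "wred ((0, F_m) # opw t b) (shift (Suc 0) (opw t b) @ opw True b)"
proof (induction b)
  case 0
  then show ?case using wred_rules(1)[of "[]"] by simp
next
  case (Suc b)
  have "wred ((0, F_m) # opw t (Suc b))
      ((Suc 0, F_s) # (0, F_s) # shift (Suc 0) ((0, F_m) # opw t b))"
    using wred_rules(10) by simp
  also have "wred \<dots> ((Suc 0, F_s) # (0, F_s) # shift (Suc 0) (shift (Suc 0) (opw t b) @ opw True b))"
    by (intro wred_Cons wred_shift Suc.IH)
  also have "wred \<dots> ((Suc 0, F_s) # shift (Suc (Suc 0)) (opw t b) @ (0, F_s) # shift (Suc 0) (opw True b))"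
    using wred_Cons[OF wred_interchange_s(1)] by simp
  finally show ?case by simp
qed

section \<open>Units sink to the bottom\<close>

definition units :: "nat list \<Rightarrow> F_gate word" where
  "units js = map (\<lambda>j. (j, F_e)) js"

lemma units_simps [simp]:
  "units [] = []" "units (j # js) = (j, F_e) # units js" "units (ks @ js) = units ks @ units js"
  by (simp_all add: units_def)

text \<open>The inserted string is a unit: it slides across the \<open>b\<close> strings without
  leaving crossings and is absorbed at the end if it merges. So \<open>js\<close> is
  \<open>[]\<close> or \<open>[b]\<close>.\<close>

lemma wred_e_opw: "\<exists>js. wred ((0, F_e) # opw t b) (units js)"
proof (induction b)
  case 0
  show ?case
  proof (cases t)
    case True
    then have "wred ((0, F_e) # opw t 0) (units [])" using wred_rules(2)[of "[]"] by simp
    then show ?thesis by blast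
  next
    case False
    then have "(0, F_e) # opw t 0 = units [0]" by simp
    then show ?thesis by (metis rtranclp.rtrancl_refl)
  qed
next
  case (Suc b)
  obtain js where IH: "wred ((0, F_e) # opw t b) (units js)" using Suc.IH by blast
  have "wred ((0, F_e) # opw t (Suc b)) (shift (Suc 0) ((0, F_e) # opw t b))"
    using wred_rules(8) by simp
  also have "wred \<dots> (shift (Suc 0) (units js))"
    by (rule wred_shift[OF IH])
  also have "\<dots> = units (map Suc js)"
    by (simp add: units_def shift_def)
  finally show ?case by blast
qed

lemma shift_units: "shift (Suc 0) (units js) = units (map Suc js)"
  by (simp add: units_def shift_def)

text \<open>The unit lies to the right of the inserted string. A crossing with it disappears and
  leaves it behind on the left; a merge with it disappears together with the unit; otherwise the two
  pass each other. Hence both \<open>t\<close> and \<open>b\<close> may change.\<close>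

lemma wred_unit_opw: "\<exists>t' b' js. wred ((Suc j, F_e) # opw t b) (opw t' b' @ units js)"
proof (induction b arbitrary: j)
  case 0
  show ?case
  proof (cases t)
    case True
    show ?thesis
    proof (cases j)
      case 0
      have "wred ((Suc j, F_e) # opw t 0) (opw False 0 @ units [])"
        using 0 True wred_rules(3)[of "[]"] by simp
      then show ?thesis by blast
    next
      case (Suc i)
      have "wred ((Suc j, F_e) # opw t 0) (opw True 0 @ units [j])"
        using True Suc wred_interchange_m(2)[of "[(i, F_e)]" "[]"] by simp
      then show ?thesis by blast
    qed
  next
    case False
    then have "(Suc j, F_e) # opw t 0 = opw False 0 @ units [Suc j]" by simp
    then show ?thesis by (metis rtranclp.rtrancl_refl)
  qed
next
  case (Suc b)
  show ?case
  proof (cases j)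
    case 0
    have "wred ((Suc j, F_e) # opw t (Suc b)) ((0, F_e) # shift (Suc 0) (opw t b))"
      using 0 wred_rules(9) by simp
    also have "wred \<dots> (opw t b @ units [0])"
      using wred_interchange_e(1)[of "opw t b" "[]"] by simp
    finally show ?thesis by blast
  next
    case (Suc i)
    obtain t' b' js where IH: "wred ((Suc i, F_e) # opw t b) (opw t' b' @ units js)"
      using Suc.IH by blast
    have "wred ((Suc j, F_e) # opw t (Suc b)) ((0, F_s) # shift (Suc 0) ((Suc i, F_e) # opw t b))"
      using wred_interchange_s(2)[of "[(i, F_e)]"] Suc by simp
    also have "wred \<dots> ((0, F_s) # shift (Suc 0) (opw t' b' @ units js))"
      by (intro wred_Cons wred_shift IH)
    also have "\<dots> = opw t' (Suc b') @ units (map Suc js)"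
      by (simp add: shift_units)
    finally show ?thesis by blast
  qed
qed

lemma wred_units_opw:
  "\<exists>t' b' js'. wred (shift (Suc 0) (units js) @ opw t b) (opw t' b' @ units js')"
proof (induction js)
  case Nil
  have "shift (Suc 0) (units []) @ opw t b = opw t b @ units []" by simp
  then show ?case by (metis rtranclp.rtrancl_refl)
next
  case (Cons j js)
  obtain t1 b1 ks where 1: "wred (shift (Suc 0) (units js) @ opw t b) (opw t1 b1 @ units ks)"
    using Cons.IH by blast
  obtain t2 b2 ks' where 2: "wred ((Suc j, F_e) # opw t1 b1) (opw t2 b2 @ units ks')"
    using wred_unit_opw by blast
  have "wred (shift (Suc 0) (units (j # js)) @ opw t b) ((Suc j, F_e) # opw t1 b1 @ units ks)"
    using wred_Cons[OF 1] by simp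
  also have "wred \<dots> (opw t2 b2 @ units (ks' @ ks))"
    using wred_append2[OF 2] by simp
  finally show ?case by blast
qed

text \<open>The words \<open>surjw S\<close> are the canonical forms of surjections.\<close>

fun surjw :: "(bool \<times> nat) list \<Rightarrow> F_gate word" where
  "surjw [] = []"
| "surjw ((t, b) # S) = shift (Suc 0) (surjw S) @ opw t b"

text \<open>At offset 0 the letter meets only the insertions of the first one or two inputs. At a
  positive offset it lies to the right of the first input and acts on the remaining insertions; the
  units this produces must then sink through the insertion of the first input.\<close>

lemma wred_letter_surjw:
  assumes "k + gate_out g \<le> length S"
  shows "\<exists>S' js. length S' + gate_out g = length S + gate_in g \<and>
    wred ((k, g) # surjw S) (surjw S' @ units js)"
  using assms
proof (induction k arbitrary: S)
  case 0
  show ?case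
  proof (cases g)
    case F_m
    then obtain t b S0 where S: "S = (t, b) # S0"
      using 0 by (cases S) auto
    have "wred ((0, g) # surjw S) (shift (Suc (Suc 0)) (surjw S0) @ (0, F_m) # opw t b)"
      using wred_interchange_m(1) F_m S by simp
    also have "wred \<dots> (shift (Suc (Suc 0)) (surjw S0) @ shift (Suc 0) (opw t b) @ opw True b)"
      by (rule wred_append1[OF wred_m_opw])
    also have "\<dots> = surjw ((True, b) # (t, b) # S0) @ units []" by simp
    finally show ?thesis
      by (intro exI[of _ "(True, b) # (t, b) # S0"] exI[of _ "[]"] conjI) (simp_all add: F_m S)
  next
    case F_e
    then obtain t b S0 where S: "S = (t, b) # S0"
      using 0 by (cases S) auto
    obtain js where js: "wred ((0, F_e) # opw t b) (units js)" using wred_e_opw by blast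
    have "wred ((0, g) # surjw S) (surjw S0 @ (0, F_e) # opw t b)"
      using wred_interchange_e(1) F_e S by simp
    also have "wred \<dots> (surjw S0 @ units js)"
      by (rule wred_append1[OF js])
    finally show ?thesis
      by (intro exI[of _ S0] exI[of _ js] conjI) (simp_all add: F_e S)
  next
    case F_s
    then obtain t b t' b' S0 where S: "S = (t', b') # (t, b) # S0"
      using 0 by (auto simp: numeral_2_eq_2 Suc_le_length_iff)
    obtain t1 b1 t2 b2 where w: "wred ((0, F_s) # shift (Suc 0) (opw t b) @ opw t' b')
        (shift (Suc 0) (opw t1 b1) @ opw t2 b2)"
      using wred_s_opw_opw by blast
    have "wred ((0, g) # surjw S)
        (shift (Suc (Suc 0)) (surjw S0) @ (0, F_s) # shift (Suc 0) (opw t b) @ opw t' b')"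
      using wred_interchange_s(1) F_s S by simp
    also have "wred \<dots> (shift (Suc (Suc 0)) (surjw S0) @ shift (Suc 0) (opw t1 b1) @ opw t2 b2)"
      by (rule wred_append1[OF w])
    also have "\<dots> = surjw ((t2, b2) # (t1, b1) # S0) @ units []" by simp
    finally show ?thesis
      by (intro exI[of _ "(t2, b2) # (t1, b1) # S0"] exI[of _ "[]"] conjI) (simp_all add: F_s S)
  qed
next
  case (Suc k)
  then obtain t b S0 where S: "S = (t, b) # S0" by (cases S) auto
  then obtain S1 js where 1: "length S1 + gate_out g = length S0 + gate_in g"
    "wred ((k, g) # surjw S0) (surjw S1 @ units js)"
    using Suc.IH[of S0] Suc.prems by auto
  obtain t' b' js' where 2: "wred (shift (Suc 0) (units js) @ opw t b) (opw t' b' @ units js')"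
    using wred_units_opw by blast
  have "wred ((Suc k, g) # surjw S) (shift (Suc 0) (surjw S1 @ units js) @ opw t b)"
    using wred_append2[OF wred_shift[OF 1(2), of "Suc 0"]] S by simp
  also have "\<dots> = shift (Suc 0) (surjw S1) @ shift (Suc 0) (units js) @ opw t b" by simp
  also have "wred \<dots> (shift (Suc 0) (surjw S1) @ opw t' b' @ units js')"
    by (rule wred_append1[OF 2])
  finally show ?case
    using 1(1) S by (intro exI[of _ "(t', b') # S1"] exI[of _ js'] conjI) simp_all
qed

text \<open>
  In \<open>unitw \<beta>\<close> the entries \<open>True\<close> are the incoming strings and the entries \<open>False\<close> the created
  units; incoming strings beyond the end of \<open>\<beta>\<close> are allowed.
\<close>

fun unitw :: "bool list \<Rightarrow> F_gate word" where
  "unitw [] = []"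
| "unitw (True # \<beta>) = shift (Suc 0) (unitw \<beta>)"
| "unitw (False # \<beta>) = (0, F_e) # shift (Suc 0) (unitw \<beta>)"

lemma unitw_single: "unitw (replicate j True @ [False]) = [(j, F_e)]"
  by (induction j) auto

lemma wred_unit_unitw: "\<exists>\<beta>'. wred ((j, F_e) # unitw \<beta>) (unitw \<beta>')"
proof (induction \<beta> arbitrary: j rule: unitw.induct)
  case 1
  \<comment> \<open>A unit beyond the end of the pattern: pad with \<open>j\<close> incoming
    strings.\<close>
  show ?case by (metis unitw.simps(1) unitw_single rtranclp.rtrancl_refl)
next
  case (2 \<beta>)
  show ?case
  proof (cases j)
    case 0
    then have "(j, F_e) # unitw (True # \<beta>) = unitw (False # \<beta>)" by simp
    then show ?thesis by (metis rtranclp.rtrancl_refl)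
  next
    case (Suc i)
    obtain \<beta>' where IH: "wred ((i, F_e) # unitw \<beta>) (unitw \<beta>')" using 2 by blast
    have "wred ((j, F_e) # unitw (True # \<beta>)) (unitw (True # \<beta>'))"
      using wred_shift[OF IH, of "Suc 0"] Suc by simp
    then show ?thesis by blast
  qed
next
  case (3 \<beta>)
  obtain \<beta>' where IH: "wred ((j, F_e) # unitw \<beta>) (unitw \<beta>')" using 3 by blast
  have "wred ((j, F_e) # unitw (False # \<beta>)) ((0, F_e) # shift (Suc 0) ((j, F_e) # unitw \<beta>))"
    using wred_interchange_e(2)[of "[(j, F_e)]"] by simp
  also have "wred \<dots> (unitw (False # \<beta>'))"
    using wred_Cons[OF wred_shift[OF IH, of "Suc 0"]] by simp
  finally show ?case by blast
qed

lemma wred_units_unitw: "\<exists>\<beta>'. wred (units js @ unitw \<beta>) (unitw \<beta>')"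
proof (induction js)
  case (Cons j js)
  then show ?case
    using wred_unit_unitw wred_Cons rtranclp_trans by (metis append_Cons units_simps(2))
qed auto

lemma surjw_replicate: "surjw (replicate p (False, 0)) = []"
  by (induction p) auto

text \<open>The letters are absorbed from the last one upwards, starting from the empty word, in
  which every input is inserted without crossing or merging.\<close>

lemma wred_canonical:
  "valid p w q \<Longrightarrow> \<exists>S \<beta>. length S = p \<and> wred w (surjw S @ unitw \<beta>)"
proof (induction w arbitrary: p)
  case Nil
  show ?case
    by (intro exI[of _ "replicate p (False, 0)"] exI[of _ "[]"]) (simp add: surjw_replicate)
next
  case (Cons l w)
  obtain k g where l: "l = (k, g)" by (cases l)
  obtain S \<beta> where S: "length S = p - gate_in g + gate_out g" "wred w (surjw S @ unitw \<beta>)"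
    using Cons l by fastforce
  have "k + gate_out g \<le> length S" using Cons.prems l S(1) by auto
  then obtain S' js where S': "length S' + gate_out g = length S + gate_in g"
    "wred ((k, g) # surjw S) (surjw S' @ units js)"
    using wred_letter_surjw by blast
  obtain \<beta>' where \<beta>': "wred (units js @ unitw \<beta>) (unitw \<beta>')" using wred_units_unitw by blast
  have "wred (l # w) (((k, g) # surjw S) @ unitw \<beta>)"
    using wred_Cons[OF S(2)] l by simp
  also have "wred \<dots> (surjw S' @ units js @ unitw \<beta>)"
    using wred_append2[OF S'(2)] by simp
  also have "wred \<dots> (surjw S' @ unitw \<beta>')"
    by (rule wred_append1[OF \<beta>'])
  finally show ?case using S(1) S'(1) Cons.prems l by auto
qed


section \<open>Canonical words are determined by their values\<close>

fun label_val :: "F_gate \<Rightarrow> nat set list \<Rightarrow> nat set list" where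
  "label_val F_m [A, B] = [A \<union> B]"
| "label_val F_e [] = [{}]"
| "label_val F_s [A, B] = [B, A]"
| "label_val _ _ = []"

text \<open>
  Running a diagram on distinct singletons lists the fibres of the map that it denotes.
\<close>

abbreviation "run_labels \<equiv> wval label_val"

definition singletons :: "nat list \<Rightarrow> nat set list" where
  "singletons xs = map (\<lambda>i. {i}) xs"

definition labels :: "F_gate diagram \<Rightarrow> nat set list" where
  "labels d = (THE ys. \<exists>n c. drun label_val (\<lambda>_ _. 0) d (singletons [0..<n]) ys c)"

lemma arity_respecting_label: "arity_respecting label_val"
  unfolding arity_respecting_def
proof (intro allI impI)
  fix g :: F_gate and xs :: "nat set list"
  assume "length xs = gate_in g"
  then show "length (label_val g xs) = gate_out g"
    by (cases g) (auto simp: numeral_2_eq_2 length_Suc_conv)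
qed

lemma labels_wdiag:
  assumes "valid p w q"
  shows "labels (wdiag p w) = run_labels w (singletons [0..<p])"
proof -
  note drun = drun_wdiag[OF arity_respecting_label assms]
  have "length (singletons [0..<p]) = p" by (simp add: singletons_def)
  then have "\<exists>c. drun label_val (\<lambda>_ _. 0) (wdiag p w) (singletons [0..<p])
      (run_labels w (singletons [0..<p])) c"
    using drun by blast
  moreover have "n = p" "ys = run_labels w (singletons [0..<n])"
    if "drun label_val (\<lambda>_ _. 0) (wdiag p w) (singletons [0..<n]) ys c" for n ys c
    using that drun by (auto simp: singletons_def)
  ultimately show ?thesis
    unfolding labels_def by (intro the_equality) blast+
qed

text \<open>Union is associative and commutative with unit \<open>{}\<close>, and crossings only
  permute; the rules are instances of these laws.\<close>

lemma rule_labels: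
  assumes "(n, u, v) \<in> F_word_rules" "n \<le> length zs"
  shows "run_labels v zs = run_labels u zs"
  by (rule F_word_rules_on_lists[OF assms]) (simp_all add: Un_ac)

lemma rewrite_step_labels:
  assumes "rewrite_step F_rules d d'"
  shows "labels d' = labels d"
  using assms
proof (cases rule: rewrite_step_wordE)
  case (1 p q n u v a k b)
  let ?A = "run_labels a (singletons [0..<p])"
  have w: "k + n \<le> length ?A"
    using rule_context_width[OF arity_respecting_label 1(1), of "singletons [0..<p]" a k b q] 1(2)
    by (simp add: singletons_def)
  then have "run_labels v (drop k ?A) = run_labels u (drop k ?A)"
    by (intro rule_labels[OF 1(1)]) simp
  then show ?thesis
    unfolding 1(4,5) labels_wdiag[OF 1(2)] labels_wdiag[OF 1(3)]
    using w by (simp add: wval_context)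
qed

lemma rewrite_steps_labels: "(rewrite_step F_rules)\<^sup>*\<^sup>* d d' \<Longrightarrow> labels d' = labels d"
  by (induction rule: rtranclp_induct) (simp_all add: rewrite_step_labels)

section \<open>Recovering a canonical word from its labels\<close>

lemma run_labels_opw:
  "run_labels (opw False 0) (x # ys) = x # ys"
  "run_labels (opw True 0) (x # y # ys) = (x \<union> y) # ys"
  "run_labels (opw t (Suc b)) (x # y # ys) = y # run_labels (opw t b) (x # ys)"
  by (simp_all add: wval_shift_Cons)

lemma valid_opw_SucD:
  assumes "valid (Suc (length ys)) (opw t (Suc b)) q"
  obtains y r q' where "ys = y # r" "valid (Suc (length r)) (opw t b) q'"
proof -
  obtain y r where ys: "ys = y # r" using assms by (cases ys) auto
  then have "valid (Suc (Suc (length r))) (shift 1 (opw t b)) q"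
    using assms by (simp add: numeral_2_eq_2)
  then show thesis
    using that[OF ys] valid_Suc_shiftD by blast
qed

text \<open>The number of entries before the one that contains \<open>i\<close> is the number of
  crossings. The string has merged exactly if that entry contains more than \<open>i\<close>, and
  removing \<open>i\<close> from it gives back the old entry, because the other labels are nonempty
  and do not contain \<open>i\<close>.\<close>

lemma opw_inj:
  assumes "valid (Suc (length ys)) (opw t b) q" "valid (Suc (length ys')) (opw t' b') q'"
    and "run_labels (opw t b) ({i} # ys) = run_labels (opw t' b') ({i} # ys')"
    and "\<And>y. y \<in> set ys \<union> set ys' \<Longrightarrow> y \<noteq> {} \<and> i \<notin> y"
  shows "t = t' \<and> b = b' \<and> ys = ys'"
  using assms
proof (induction b arbitrary: b' ys ys' q q')
  case 0
  show ?case
  proof (cases b')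
    case (Suc c)
    then obtain y' r' where ys': "ys' = y' # r'" using 0(2) by (blast elim: valid_opw_SucD)
    \<comment> \<open>Without crossings \<open>i\<close> stays in the first entry, whereas on the
      other side that entry is \<open>y'\<close>.\<close>
    have "i \<in> hd (run_labels (opw t 0) ({i} # ys))"
    proof (cases t)
      case True
      then obtain y r where "ys = y # r" using 0(1) True by (cases ys) auto
      then show ?thesis using True run_labels_opw by simp
    qed simp
    then show ?thesis
      using 0(3,4) run_labels_opw(3) by (simp add: ys' Suc del: opw.simps)
  next
    case b': 0
    show ?thesis
    proof (cases t; cases t')
      assume t: "t" "t'"
      obtain y r where y: "ys = y # r" using 0(1) t by (cases ys) auto
      obtain y' r' where y': "ys' = y' # r'" using 0(2) t b' by (cases ys') auto
      note ys = y y'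
      then have "insert i y = insert i y'" "r = r'" using 0(3) t b' by simp_all
      moreover have "i \<notin> y" "i \<notin> y'" using 0(4) ys by auto
      ultimately show ?thesis using t b' ys by (metis insert_ident)
    next
      assume t: "t" "\<not> t'"
      obtain y r where ys: "ys = y # r" using 0(1) t by (cases ys) auto
      then have "insert i y = {i}" using 0(3) t b' by simp
      moreover have "i \<notin> y" "y \<noteq> {}" using 0(4) ys by auto
      ultimately show ?thesis by blast
    next
      assume t: "\<not> t" "t'"
      obtain y r where ys: "ys' = y # r" using 0(2) t b' by (cases ys') auto
      then have "insert i y = {i}" using 0(3) t b' by simp
      moreover have "i \<notin> y" "y \<noteq> {}" using 0(4) ys by auto
      ultimately show ?thesis by blast
    next
      assume "\<not> t" "\<not> t'"
      then show ?thesis using 0(3) b' by simp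
    qed
  qed
next
  case (Suc b)
  obtain y r s where ys: "ys = y # r" and s: "valid (Suc (length r)) (opw t b) s"
    using Suc.prems(1) by (blast elim: valid_opw_SucD)
  show ?case
  proof (cases b')
    case 0
    have "i \<in> hd (run_labels (opw t' 0) ({i} # ys'))"
    proof (cases t')
      case True
      then obtain y r where "ys' = y # r" using Suc.prems(2) 0 True by (cases ys') auto
      then show ?thesis using True run_labels_opw by simp
    qed simp
    then show ?thesis
      using Suc.prems(4) Suc.prems(3)[symmetric] run_labels_opw(3)
      by (simp add: ys 0 del: opw.simps)
  next
    case b': (Suc c)
    then obtain y' r' s' where ys': "ys' = y' # r'" and s': "valid (Suc (length r')) (opw t' c) s'"
      using Suc.prems(2) by (blast elim: valid_opw_SucD)
    have eq: "y = y'" "run_labels (opw t b) ({i} # r) = run_labels (opw t' c) ({i} # r')"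
      using Suc.prems(3) unfolding ys ys' b' run_labels_opw(3) by simp_all
    have "t = t' \<and> b = c \<and> r = r'"
      using Suc.prems(4) by (intro Suc.IH[OF s s' eq(2)]) (auto simp: ys ys')
    then show ?thesis
      using eq(1) by (simp add: ys ys' b')
  qed
qed

text \<open>Without units every label is a union of input labels, so any property closed under union
  is inherited. It is applied to nonemptiness and to the absence of a given label.\<close>

lemma run_labels_unit_free:
  assumes "\<And>A B. P A \<Longrightarrow> P B \<Longrightarrow> P (A \<union> B)" "F_e \<notin> snd ` set w" "\<And>y. y \<in> set xs \<Longrightarrow> P y"
  shows "y \<in> set (run_labels w xs) \<Longrightarrow> P y"
  using assms(2,3)
proof (induction w arbitrary: xs)
  case (Cons l w)
  obtain k g where l: "l = (k, g)" by (cases l)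
  have "g \<noteq> F_e" using Cons.prems(2) l by auto
  then have gate: "P z" if "z \<in> set (label_val g zs)" "\<And>z. z \<in> set zs \<Longrightarrow> P z" for z zs
    using that(1)
    by (cases "(g, zs)" rule: label_val.cases) (use that(2) assms(1) in auto)
  show ?case
  proof (rule Cons.IH)
    show "y \<in> set (run_labels w (take k xs @ label_val g (take (gate_in g) (drop k xs)) @
        drop (k + gate_in g) xs))"
      using Cons.prems(1) l by simp
    show "F_e \<notin> snd ` set w" using Cons.prems(2) by auto
    fix z
    assume "z \<in> set (take k xs @ label_val g (take (gate_in g) (drop k xs)) @ drop (k + gate_in g) xs)"
    then consider "z \<in> set (take k xs)" | "z \<in> set (drop (k + gate_in g) xs)"
      | "z \<in> set (label_val g (take (gate_in g) (drop k xs)))"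
      by auto
    then show "P z"
    proof cases
      case 3
      then show ?thesis
        by (rule gate) (use Cons.prems(3) in_set_takeD in_set_dropD in metis)
    qed (use Cons.prems(3) in_set_takeD in_set_dropD in metis)+
  qed
qed simp

lemma snd_shift: "snd ` set (shift k w) = snd ` set w"
  by (force simp: shift_def)

lemma opw_unit_free: "F_e \<notin> snd ` set (opw t b)"
  by (induction b) (auto simp: snd_shift)

lemma surjw_unit_free: "F_e \<notin> snd ` set (surjw S)"
  by (induction S rule: surjw.induct) (auto simp: snd_shift image_Un opw_unit_free)

text \<open>The list \<open>ks\<close> generalises \<open>[0..<p]\<close> so that the first input
  can be removed. Its insertion comes last in the word, hence \<open>opw_inj\<close> recovers it
  together with the labels of everything above.\<close>

lemma surjw_inj:
  assumes "distinct ks" "length S = length ks" "length T = length ks"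
    and "valid (length ks) (surjw S) q" "valid (length ks) (surjw T) q'"
    and "run_labels (surjw S) (singletons ks) = run_labels (surjw T) (singletons ks)"
  shows "S = T"
  using assms
proof (induction ks arbitrary: S T q q')
  case (Cons i ks)
  obtain t b S0 where S: "S = (t, b) # S0" using Cons.prems(2) by (cases S) auto
  obtain t' b' T0 where T: "T = (t', b') # T0" using Cons.prems(3) by (cases T) auto
  let ?ys = "run_labels (surjw S0) (singletons ks)" and ?ys' = "run_labels (surjw T0) (singletons ks)"
  have split: "\<exists>r. valid (length ks) (surjw U) r \<and> valid (Suc r) (opw t b) q"
    if "valid (Suc (length ks)) (surjw ((t, b) # U)) q" for t b U q
    using that valid_Suc_shiftD[of "length ks" "surjw U"] unfolding surjw.simps valid_append
    by (metis One_nat_def)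
  obtain r where r: "valid (length ks) (surjw S0) r" "valid (Suc r) (opw t b) q"
    using split Cons.prems(4) unfolding S length_Cons by blast
  obtain r' where r': "valid (length ks) (surjw T0) r'" "valid (Suc r') (opw t' b') q'"
    using split Cons.prems(5) unfolding T length_Cons by blast
  have "length (singletons ks) = length ks" by (simp add: singletons_def)
  then have len: "length ?ys = r" "length ?ys' = r'"
    using length_wval[OF arity_respecting_label] r(1) r'(1) by metis+
  have fresh: "y \<noteq> {} \<and> i \<notin> y" if "y \<in> set (run_labels (surjw U) (singletons ks))" for y U
  proof (rule run_labels_unit_free[where P = "\<lambda>y. y \<noteq> {} \<and> i \<notin> y", OF _ surjw_unit_free _ that])
    show "z \<noteq> {} \<and> i \<notin> z" if "z \<in> set (singletons ks)" for z
      using that Cons.prems(1) by (auto simp: singletons_def)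
  qed simp
  have "t = t' \<and> b = b' \<and> ?ys = ?ys'"
  proof (rule opw_inj)
    show "run_labels (opw t b) ({i} # ?ys) = run_labels (opw t' b') ({i} # ?ys')"
      using Cons.prems(6) by (simp add: S T wval_append singletons_def wval_shift_Cons)
    show "valid (Suc (length ?ys)) (opw t b) q" "valid (Suc (length ?ys')) (opw t' b') q'"
      using r(2) r'(2) unfolding len .
    show "y \<noteq> {} \<and> i \<notin> y" if "y \<in> set ?ys \<union> set ?ys'" for y
      using that fresh by blast
  qed
  moreover from this have "S0 = T0"
    using Cons.IH[of S0 T0 r r'] Cons.prems(1-3) r(1) r'(1) by (simp add: S T)
  ultimately show ?case by (simp add: S T)
qed simp

text \<open>This is \<open>unitw\<close> for the pattern that has \<open>False\<close> exactly at
  the empty sets of the list.\<close>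

primrec emptyw :: "nat set list \<Rightarrow> F_gate word" where
  "emptyw [] = []"
| "emptyw (z # zs) = (if z = {} then [(0, F_e)] else []) @ shift (Suc 0) (emptyw zs)"

text \<open>Only the created units carry the empty label. The pattern \<beta> cannot be recovered,
  since trailing entries \<open>True\<close> do not change the word, but the word itself
  can.\<close>

lemma unitw_eq_emptyw:
  "valid (length ys) (unitw \<beta>) q \<Longrightarrow> {} \<notin> set ys \<Longrightarrow>
    unitw \<beta> = emptyw (run_labels (unitw \<beta>) ys) \<and> ys = filter (\<lambda>y. y \<noteq> {}) (run_labels (unitw \<beta>) ys)"
proof (induction \<beta> arbitrary: ys q rule: unitw.induct)
  case 1
  have "{} \<notin> set zs \<Longrightarrow> emptyw zs = []" for zs by (induction zs) auto
  moreover have "ys = filter (\<lambda>y. y \<noteq> {}) ys"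
    by (rule sym, rule filter_True) (use 1(2) in auto)
  ultimately show ?case using 1(2) by simp
next
  case (2 \<beta>)
  show ?case
  proof (cases ys)
    case Nil
    \<comment> \<open>A letter with positive offset cannot be valid on zero strings.\<close>
    then have "unitw \<beta> = []"
      using 2(2) by (cases "unitw \<beta>") auto
    then show ?thesis using Nil by simp
  next
    case (Cons y r)
    from 2(2) Cons have "valid (Suc (length r)) (shift 1 (unitw \<beta>)) q" by simp
    then obtain q' where "valid (length r) (unitw \<beta>) q'"
      using valid_Suc_shiftD by blast
    then show ?thesis
      using 2(1)[of r] 2(3) Cons by (auto simp: wval_shift_Cons)
  qed
next
  case (3 \<beta>)
  from 3(2) have "valid (Suc (length ys)) (shift 1 (unitw \<beta>)) q" by simp
  then obtain q' where "valid (length ys) (unitw \<beta>) q'"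
    using valid_Suc_shiftD by blast
  then show ?case
    using 3(1)[of ys] 3(3) by (auto simp: wval_shift_Cons)
qed

text \<open>The output labels split: the empty ones give the units, the nonempty ones are the labels
  between the two halves of the word and hence give the insertions.\<close>

lemma canonical_unique:
  assumes "length S = p" "length T = p"
    and "valid p (surjw S @ unitw \<beta>) q" "valid p (surjw T @ unitw \<gamma>) q'"
    and "run_labels (surjw S @ unitw \<beta>) (singletons [0..<p]) =
      run_labels (surjw T @ unitw \<gamma>) (singletons [0..<p])"
  shows "surjw S @ unitw \<beta> = surjw T @ unitw \<gamma>"
proof -
  let ?x = "singletons [0..<p]"
  let ?y = "run_labels (surjw S) ?x" and ?z = "run_labels (surjw T) ?x"
  have x: "length ?x = p" by (simp add: singletons_def)
  obtain r r' where r: "valid p (surjw S) r" "valid r (unitw \<beta>) q"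
    "valid p (surjw T) r'" "valid r' (unitw \<gamma>) q'"
    using assms(3,4) by (auto simp: valid_append)
  have len: "length ?y = r" "length ?z = r'"
    using r x by (auto intro: length_wval[OF arity_respecting_label])
  have "y \<noteq> {}" if "y \<in> set (run_labels (surjw U) ?x)" for y U
    by (rule run_labels_unit_free[where P = "\<lambda>y. y \<noteq> {}", OF _ surjw_unit_free _ that])
      (auto simp: singletons_def)
  then have ne: "{} \<notin> set ?y" "{} \<notin> set ?z" by blast+
  have y: "unitw \<beta> = emptyw (run_labels (unitw \<beta>) ?y)" "?y = filter (\<lambda>y. y \<noteq> {}) (run_labels (unitw \<beta>) ?y)"
    using unitw_eq_emptyw[of ?y \<beta> q] r(2) len(1) ne(1) by blast+
  have z: "unitw \<gamma> = emptyw (run_labels (unitw \<gamma>) ?z)" "?z = filter (\<lambda>y. y \<noteq> {}) (run_labels (unitw \<gamma>) ?z)"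
    using unitw_eq_emptyw[of ?z \<gamma> q'] r(4) len(2) ne(2) by blast+
  have eq: "run_labels (unitw \<beta>) ?y = run_labels (unitw \<gamma>) ?z"
    using assms(5) by (simp add: wval_append)
  have "?y = ?z" using y(2) z(2) eq by metis
  then have "S = T"
    using surjw_inj[of "[0..<p]" S T r r'] assms(1,2) r by simp
  moreover have "unitw \<beta> = unitw \<gamma>" using y(1) z(1) eq by metis
  ultimately show ?thesis by simp
qed

lemma F_rules_confluent: "drs_confluent F_rules"
  unfolding drs_confluent_def
proof (intro allI impI)
  fix d d1 d2
  assume step: "rewrite_step F_rules d d1" "rewrite_step F_rules d d2"
  obtain p q v1 where v1: "valid p v1 q" "d1 = wdiag p v1" and d1: "darity d p q"
    using step(1) by (elim rewrite_step_wordE) (auto dest: wdiag_arity)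
  obtain p' q' v2 where v2: "valid p' v2 q'" "d2 = wdiag p' v2" and d2: "darity d p' q'"
    using step(2) by (elim rewrite_step_wordE) (auto dest: wdiag_arity)
  \<comment> \<open>The common source fixes the arity, so both canonical words insert the same
    number of inputs.\<close>
  have pq: "p' = p" "q' = q" using darity_unique[OF d1 d2] by auto
  obtain S \<beta> where S: "length S = p" "wred v1 (surjw S @ unitw \<beta>)"
    using wred_canonical[OF v1(1)] by blast
  obtain T \<gamma> where T: "length T = p" "wred v2 (surjw T @ unitw \<gamma>)"
    using wred_canonical[OF v2(1)] pq by blast
  note r1 = wred_valid[OF S(2) v1(1)] and r2 = wred_valid[OF T(2) v2(1)[unfolded pq]]
  have "labels (wdiag p (surjw S @ unitw \<beta>)) = labels d"
    using rewrite_steps_labels r1 rewrite_step_labels[OF step(1)] v1(2) by metis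
  moreover have "labels (wdiag p (surjw T @ unitw \<gamma>)) = labels d"
    using rewrite_steps_labels r2 rewrite_step_labels[OF step(2)] v2(2) pq by metis
  ultimately have "surjw S @ unitw \<beta> = surjw T @ unitw \<gamma>"
    using canonical_unique[OF S(1) T(1)] r1 r2 labels_wdiag by metis
  then show "\<exists>d'. (rewrite_step F_rules)\<^sup>*\<^sup>* d1 d' \<and> (rewrite_step F_rules)\<^sup>*\<^sup>* d2 d'"
    using r1 r2 v1(2) v2(2) pq by metis
qed

theorem mainTheorem2: "drs_convergent F_rules"
  unfolding drs_convergent_def using F_rules_terminates F_rules_confluent ..

end
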